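(* Let $\psi_0=\frac{11+5\sqrt5}{2}\approx 11.09017$. Let $f=h+\overline{g}\in\mathcal{PH}(V)$, where $V$ is a positive constant, $h$ is locally biholomorphic and $g$ is holomorphic in $\mathbb{B}^n$. Suppose $f(0)=0$, $Dg(0)=0$ and $|\det J_f(0)|=\alpha$ for some positive constant $\alpha$ with $$0<\alpha\le\frac{8V\psi_0^n}{\pi}.$$ Then there exist radii $R_u$ and $R_c$ such that $f$ is univalent in $\mathbb{B}^n(R_u)\subset\mathbb{B}^n$ and $f(\mathbb{B}^n(R_u))$ covers (i.e. contains) the ball $\mathbb{B}^n(R_c)$, where $$R_u\ge\frac{\alpha\pi(\sqrt5-1)(3-2\sqrt2)}{8V\psi_0^n}\quad\text{and}\quad R_c\ge\frac{\alpha^2\pi(\sqrt5-1)(3-2\sqrt2)}{16\,V^{\frac{4n-1}{2n}}\,\psi_0^{\frac{4n-1}{2}}}.$$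
   Context: $\|z\|=\langle z,z\rangle^{1/2}$ is the Euclidean norm on $\mathbb{C}^n$, $\mathbb{B}^n(r)=\{z\in\mathbb{C}^n:\|z\|<r\}$, and $\mathbb{B}^n=\mathbb{B}^n(1)$. For a complex $n\times n$ matrix $A$, $\|A\|=\sup_{z\ne 0}\|Az\|/\|z\|$ is the operator norm. For a holomorphic mapping $h=(h_1,\ldots,h_n)$ on $\mathbb{B}^n$, $Dh$ is the $n\times n$ matrix whose $j$-th row is $(\partial h_j/\partial z_1,\ldots,\partial h_j/\partial z_n)$; $Dg$ is defined in the same way. "Locally biholomorphic" means that $Dh(z)$ is invertible for every $z$; "univalent" means injective. $\mathcal{PH}(\mathbb{B}^n,\mathbb{C}^n)$ is the set of pluriharmonic mappings $f:\mathbb{B}^n\to\mathbb{C}^n$, i.e. mappings of the form $f=h+\overline{g}$ with $h,g:\mathbb{B}^n\to\mathbb{C}^n$ holomorphic (conjugation componentwise). $J_f$ is the real ($2n\times 2n$) Jacobian matrix of $f$ viewed as a map into $\mathbb{R}^{2n}$; one has $\det J_f=\det\begin{pmatrix}Dh&\overline{Dg}\\ Dg&\overline{Dh}\end{pmatrix}$. For $f=h+\overline{g}\in\mathcal{PH}(\mathbb{B}^n,\mathbb{C}^n)$ with $h$ locally biholomorphic, $g$ holomorphic, and $\|Dg(z)[Dh(z)]^{-1}\|<1$ for all $z\in\mathbb{B}^n$, the generalized volume function is, for $r\in(0,1)$, $$V_f(r)=\int_{\mathbb{B}^n(r)}\|Dh(z)\|^{2n}\left(1-\|Dg(z)[Dh(z)]^{-1}\|^2\right)^n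 dV(z),$$ where $dV$ is the normalized Lebesgue volume measure on $\mathbb{B}^n$ (total mass $1$). $\mathcal{PH}(V)$ denotes the class of all such $f=h+\overline{g}$ (in particular with $\|Dg[Dh]^{-1}\|<1$ in $\mathbb{B}^n$) satisfying the finiteness condition $V:=\sup_{0<r<1}V_f(r)<\infty$. *)

theory Defs
  imports "HOL-Analysis.Analysis"
begin

text \<open>
  Holomorphic maps on an open set of \<open>\<complex>\<^sup>n\<close>: Frechet differentiable at every point, with complex-linear
  derivative. The library's \<open>holomorphic_on\<close> covers one variable only.
\<close>

definition holomorphic_map_on :: "(complex^'n \<Rightarrow> complex^'n) \<Rightarrow> (complex^'n) set \<Rightarrow> bool"
  where "holomorphic_map_on h S \<longleftrightarrow>
    open S \<and> (\<forall>z\<in>S. \<exists>A :: complex^'n^'n. (h has_derivative (\<lambda>v. A *v v)) (at z))"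

text \<open>Entry \<open>(j, k)\<close> is the complex partial derivative of \<open>h\<^sub>j\<close> with respect to \<open>z\<^sub>k\<close>.\<close>

definition complex_jacobian :: "(complex^'n \<Rightarrow> complex^'n) \<Rightarrow> complex^'n \<Rightarrow> complex^'n^'n"
  where "complex_jacobian h z = (\<chi> j k. deriv (\<lambda>w. h (z + axis k w) $ j) 0)"

definition op_norm :: "complex^'n^'n \<Rightarrow> real"
  where "op_norm A = onorm (\<lambda>v. A *v v)"

definition vec_cnj :: "complex^'n \<Rightarrow> complex^'n"
  where "vec_cnj z = (\<chi> j. cnj (z $ j))"

text \<open>
  The identification of \<open>\<complex>\<^sup>n\<close> with \<open>\<real>\<^sup>2\<^sup>n\<close>: the indices \<open>Inl j\<close> carry the real parts and the indices
  \<open>Inr j\<close> the imaginary parts.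
\<close>

definition to_real_vec :: "complex^'n \<Rightarrow> real^('n + 'n)"
  where "to_real_vec z = (\<chi> i. case i of Inl j \<Rightarrow> Re (z $ j) | Inr j \<Rightarrow> Im (z $ j))"

definition of_real_vec :: "real^('n + 'n) \<Rightarrow> complex^'n"
  where "of_real_vec x = (\<chi> j. Complex (x $ Inl j) (x $ Inr j))"

definition real_jacobian :: "(complex^'n \<Rightarrow> complex^'n) \<Rightarrow> complex^'n \<Rightarrow> real^('n + 'n)^('n + 'n)"
  where "real_jacobian f z = jacobian (to_real_vec \<circ> f \<circ> of_real_vec) (at (to_real_vec z))"

definition dilatation :: "(complex^'n \<Rightarrow> complex^'n) \<Rightarrow> (complex^'n \<Rightarrow> complex^'n) \<Rightarrow> complex^'n \<Rightarrow> real"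
  where "dilatation h g z = op_norm (complex_jacobian g z ** matrix_inv (complex_jacobian h z))"

text \<open>
  Dividing by the volume of the unit ball normalizes Lebesgue measure. For \<open>h\<close> and \<open>g\<close> as in \<open>PHV\<close> below
  and \<open>r < 1\<close> the integrand is continuous on the closed ball of radius \<open>r\<close>, so the integral exists.
\<close>

definition gen_volume :: "(complex^'n \<Rightarrow> complex^'n) \<Rightarrow> (complex^'n \<Rightarrow> complex^'n) \<Rightarrow> real \<Rightarrow> real"
  where "gen_volume h g r =
    (LINT z : ball (0 :: complex^'n) r | lborel.
        op_norm (complex_jacobian h z) ^ (2 * CARD('n)) * (1 - (dilatation h g z)\<^sup>2) ^ CARD('n))
    / measure lborel (ball (0 :: complex^'n) 1)"

text \<open>
  \<open>PHV V f h g\<close>: the map \<open>f\<close>, with decomposition \<open>f = h + cnj g\<close> on the unit ball, belongs to the class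
  \<open>\<P>\<H>(V)\<close>. The set of volumes is required to be bounded above because \<open>Sup\<close> on the reals is
  unspecified otherwise.
\<close>

definition PHV :: "real \<Rightarrow> (complex^'n \<Rightarrow> complex^'n) \<Rightarrow> (complex^'n \<Rightarrow> complex^'n)
    \<Rightarrow> (complex^'n \<Rightarrow> complex^'n) \<Rightarrow> bool"
  where "PHV V f h g \<longleftrightarrow>
    holomorphic_map_on h (ball 0 1) \<and>
    holomorphic_map_on g (ball 0 1) \<and>
    (\<forall>z\<in>ball 0 1. f z = h z + vec_cnj (g z)) \<and>
    (\<forall>z\<in>ball 0 1. invertible (complex_jacobian h z)) \<and>
    (\<forall>z\<in>ball 0 1. dilatation h g z < 1) \<and>
    bdd_above (gen_volume h g ` {0<..<1}) \<and>
    V = (SUP r\<in>{0<..<1}. gen_volume h g r)"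

definition \<psi>\<^sub>0 :: real
  where "\<psi>\<^sub>0 = (11 + 5 * sqrt 5) / 2"

end

theory Submission
  imports Defs "HOL-Complex_Analysis.Complex_Analysis"
begin

text \<open>
  Let \<open>M ^ (2n) = V \<psi>\<^sub>0 ^ n\<close> and \<open>A = Dh(0)\<close>. The radii come from comparing \<open>f\<close> with the linear map \<open>A\<close>
  near the origin, and the comparison rests on three estimates.

  The first bounds \<open>Dh\<close>. The matrix function \<open>Dg [Dh]\<^sup>-\<^sup>1\<close> has norm less than \<open>1\<close> and vanishes at the
  origin, so by the Schwarz lemma its norm at \<open>z\<close> is at most \<open>\<parallel>z\<parallel>\<close> (\<open>PHV_dilatation_le\<close>). Hence the volume
  integrand is at least \<open>\<parallel>Dh(z)\<parallel> ^ (2n) (1 - \<parallel>z\<parallel>\<^sup>2) ^ n\<close>. As \<open>\<parallel>Dh(z) u\<parallel> ^ (2n)\<close> is subharmonic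
  (\<open>sub_mean_value_norm_power\<close>), its value at a point of the ball of radius \<open>1/4\<close> is at most its mean over
  the ball of radius \<open>1/2\<close> about that point, and the bound \<open>V\<close> for the integral gives \<open>\<parallel>Dh(z)\<parallel> \<le> M\<close>
  (\<open>PHV_distortion\<close>, \<open>PHV_jacobian_le\<close>).

  The second bounds \<open>A\<close> from below. Since \<open>Dg(0) = 0\<close>, the real Jacobian matrix of \<open>f\<close> at the origin
  is that of \<open>A\<close>. Its \<open>2n\<close> singular values have the product \<open>\<alpha>\<close> and are at most \<open>M\<close>, so that
  \<open>\<parallel>A v\<parallel> \<ge> \<mu> \<parallel>v\<parallel>\<close> with \<open>\<mu> = \<alpha> / M ^ (2n - 1)\<close> (\<open>abs_det_real_jacobian_mult_norm_le\<close>).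

  The third bounds the change of the derivative. The Schwarz lemma for \<open>Dh(z) - A\<close> and the estimate
  \<open>\<parallel>Dg(z)\<parallel> \<le> \<parallel>z\<parallel> \<parallel>Dh(z)\<parallel>\<close> show that the derivative of \<open>f\<close> at \<open>z\<close> differs from \<open>A\<close> by at most
  \<open>9 M \<parallel>z\<parallel>\<close> if \<open>\<parallel>z\<parallel> < 1/4\<close> (\<open>PHV_derivative_close\<close>).

  Therefore \<open>f\<close> is injective on the ball of radius \<open>\<mu> / (9M) = \<alpha> / (9 V \<psi>\<^sub>0 ^ n)\<close>, and the image of this ball
  contains the ball of radius \<open>\<mu>\<^sup>2 / (18M) = \<alpha>\<^sup>2 / (18 M ^ (4n - 1))\<close> about the origin
  (\<open>inj_on_and_ball_covering\<close>). The numerical inequality \<open>landau_constant_le\<close> shows that these radii are at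
  least those required.
\<close>

section \<open>A lower bound for the least singular value\<close>

text \<open>
  For a matrix of norm at most \<open>K\<close> the Leibniz formula only gives \<open>\<bar>det B\<bar> \<le> N! K ^ N\<close>, with \<open>N\<close> the
  dimension. Applied to the powers of \<open>B\<close>, whose norms are at most \<open>K ^ m\<close>, it gives \<open>\<bar>det B\<bar> ^ m \<le> N! (K ^ N) ^ m\<close> for all
  \<open>m\<close>, and the factor \<open>N!\<close> is lost in the limit.
\<close>

lemma abs_det_le_power:
  fixes B :: "real^'m^'m"
  assumes K: "K > 0" and B: "\<And>x. norm (B *v x) \<le> K * norm x"
  shows "\<bar>det B\<bar> \<le> K ^ CARD('m)"
proof (rule ccontr)
  let ?N = "CARD('m)"
  assume "\<not> \<bar>det B\<bar> \<le> K ^ ?N"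
  then have q: "\<bar>det B\<bar> / K ^ ?N > 1"
    using K by (simp add: field_simps)
  define P where "P m = ((\<lambda>A. B ** A) ^^ m) (mat 1)" for m
  have P_Suc: "P (Suc m) = B ** P m" for m
    by (simp add: P_def)
  have P_bound: "norm (P m *v x) \<le> K ^ m * norm x" for m x
  proof (induction m)
    case (Suc m)
    have "norm (P (Suc m) *v x) \<le> K * norm (P m *v x)"
      using B[of "P m *v x"] by (simp add: P_Suc matrix_vector_mul_assoc)
    also have "\<dots> \<le> K * (K ^ m * norm x)"
      using Suc K by (intro mult_left_mono) auto
    finally show ?case by simp
  qed (simp add: P_def)
  have det_P: "det (P m) = det B ^ m" for m
    by (induction m) (simp_all add: P_Suc det_mul, simp add: P_def)
  have entry: "\<bar>P m $ i $ j\<bar> \<le> K ^ m" for m i j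
  proof -
    have "\<bar>P m $ i $ j\<bar> = \<bar>(P m *v axis j 1) $ i\<bar>"
      by (simp add: matrix_vector_mult_basis column_def)
    also have "\<dots> \<le> norm (P m *v axis j 1)"
      by (rule component_le_norm_cart)
    also have "\<dots> \<le> K ^ m"
      using P_bound[of m "axis j 1"] by simp
    finally show ?thesis .
  qed
  have "(\<bar>det B\<bar> / K ^ ?N) ^ m \<le> fact ?N" for m
  proof -
    have "\<bar>det B\<bar> ^ m = \<bar>det (P m)\<bar>"
      by (simp add: det_P power_abs)
    also have "\<dots> \<le> (\<Sum>p | p permutes (UNIV :: 'm set). \<bar>of_int (sign p) * (\<Prod>i\<in>UNIV. P m $ i $ p i)\<bar>)"
      unfolding det_def by (rule sum_abs)
    also have "\<dots> \<le> (\<Sum>p | p permutes (UNIV :: 'm set). (K ^ m) ^ ?N)"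
    proof (rule sum_mono)
      fix p :: "'m \<Rightarrow> 'm"
      have "\<bar>of_int (sign p) * (\<Prod>i\<in>UNIV. P m $ i $ p i)\<bar> = (\<Prod>i\<in>UNIV. \<bar>P m $ i $ p i\<bar>)"
        by (simp add: abs_mult abs_prod sign_def)
      also have "\<dots> \<le> (\<Prod>i\<in>(UNIV :: 'm set). K ^ m)"
        by (intro prod_mono) (use entry in auto)
      finally show "\<bar>of_int (sign p) * (\<Prod>i\<in>UNIV. P m $ i $ p i)\<bar> \<le> (K ^ m) ^ ?N"
        by simp
    qed
    also have "\<dots> = fact ?N * (K ^ ?N) ^ m"
      by (simp add: card_permutations flip: power_mult) (simp add: mult.commute)
    finally show ?thesis
      using K by (simp add: power_divide field_simps)
  qed
  moreover obtain m where "(\<bar>det B\<bar> / K ^ ?N) ^ m > fact ?N"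
    using real_arch_pow[OF q] by blast
  ultimately show False
    by (meson not_less)
qed

text \<open>
  The determinant is up to sign the product of the singular values, and all of them are at most \<open>K\<close>;
  hence the least one is at least \<open>\<bar>det B\<bar> / K ^ (N - 1)\<close>. To avoid a singular value decomposition,
  take a unit vector \<open>v\<^sub>0\<close> at which \<open>s = \<bar>B v\<^sub>0\<bar>\<close> is least. Minimality makes \<open>B v\<^sub>0\<close> orthogonal to
  the image of the complement of \<open>v\<^sub>0\<close>, so that stretching this one column of \<open>B\<close> by \<open>K / s\<close> keeps the
  norm at most \<open>K\<close>, while it multiplies the determinant by \<open>K / s\<close>.
\<close>

lemma abs_det_mult_norm_le:
  fixes B :: "real^'m^'m"
  assumes K: "K > 0" and B: "\<And>x. norm (B *v x) \<le> K * norm x"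
  shows "\<bar>det B\<bar> * norm v \<le> K ^ (CARD('m) - 1) * norm (B *v v)"
proof -
  let ?N = "CARD('m)"
  have "continuous_on (sphere 0 1) (\<lambda>v. norm (B *v v))"
    by (intro continuous_on_norm linear_continuous_on matrix_vector_mul_bounded_linear)
  then obtain v0 where v0: "norm v0 = 1" and min: "\<And>v. norm v = 1 \<Longrightarrow> norm (B *v v0) \<le> norm (B *v v)"
    using continuous_attains_inf[of "sphere (0 :: real^'m) 1" "\<lambda>v. norm (B *v v)"] by auto
  define s where "s = norm (B *v v0)"
  have s: "s * norm v \<le> norm (B *v v)" for v
  proof (cases "v = 0")
    case False
    then have "s \<le> norm (B *v (v /\<^sub>R norm v))"
      unfolding s_def by (intro min) simp
    then show ?thesis
      using False by (simp add: matrix_vector_mult_scaleR field_simps)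
  qed simp
  have "\<bar>det B\<bar> \<le> K ^ (?N - 1) * s"
  proof (cases "s = 0")
    case True
    then have "B *v v0 = 0" by (simp add: s_def)
    moreover have "v0 \<noteq> 0" using v0 by auto
    ultimately have "\<not> invertible B"
      unfolding invertible_left_inverse matrix_left_invertible_ker by blast
    then show ?thesis
      using True by (simp add: invertible_det_nz)
  next
    case False
    then have s_pos: "s > 0" by (simp add: s_def)
    obtain k :: 'm where True by blast
    obtain Q where Q: "orthogonal_matrix Q" and Qk: "Q *v axis k 1 = v0"
      using orthogonal_matrix_exists_basis[OF v0] by blast
    define C where "C = B ** Q"
    have norm_Q: "norm (Q *v x) = norm x" for x
      using Q by (metis matrix_of_matrix_vector_mul matrix_vector_mul_linear orthogonal_transformation_matrix
          orthogonal_transformation_norm)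
    have C_upper: "norm (C *v x) \<le> K * norm x" for x
      using B[of "Q *v x"] by (simp add: C_def norm_Q matrix_vector_mul_assoc)
    have C_lower: "s * norm x \<le> norm (C *v x)" for x
      using s[of "Q *v x"] by (simp add: C_def norm_Q matrix_vector_mul_assoc)
    define w where "w = C *v axis k 1"
    have norm_w: "norm w = s"
      by (simp add: w_def C_def s_def Qk flip: matrix_vector_mul_assoc)
    have det_C: "\<bar>det C\<bar> = \<bar>det B\<bar>"
      using det_orthogonal_matrix[OF Q] by (auto simp: C_def det_mul abs_mult)
    have norm_split: "(norm (x + a *\<^sub>R axis k 1))\<^sup>2 = (norm x)\<^sup>2 + a\<^sup>2" if "x $ k = 0" for x :: "real^'m" and a
      using that unfolding power2_norm_eq_inner
      by (simp add: inner_add_left inner_add_right inner_axis inner_axis' power2_eq_square)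
    have orth: "w \<bullet> (C *v x) = 0" if x: "x $ k = 0" for x
    proof -
      define c where "c = w \<bullet> (C *v x)"
      define d where "d = (norm (C *v x))\<^sup>2 - s\<^sup>2 * (norm x)\<^sup>2"
      \<comment> \<open>First-order condition: the quadratic function \<open>\<bar>C (e\<^sub>k + t x)\<bar>\<^sup>2 - s\<^sup>2 \<bar>e\<^sub>k + t x\<bar>\<^sup>2\<close> of \<open>t\<close> is
        nonnegative and vanishes at \<open>0\<close>, so its linear coefficient is zero.\<close>
      have "2 * t * c + t\<^sup>2 * d \<ge> 0" for t
      proof -
        have "(s * norm (t *\<^sub>R x + 1 *\<^sub>R axis k 1))\<^sup>2 \<le> (norm (C *v (t *\<^sub>R x + 1 *\<^sub>R axis k 1)))\<^sup>2"
          using s_pos by (intro power_mono C_lower) simp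
        also have "C *v (t *\<^sub>R x + 1 *\<^sub>R axis k 1) = t *\<^sub>R (C *v x) + w"
          by (simp add: matrix_vector_right_distrib matrix_vector_mult_scaleR w_def)
        also have "(norm (t *\<^sub>R (C *v x) + w))\<^sup>2 = t\<^sup>2 * (norm (C *v x))\<^sup>2 + 2 * t * c + s\<^sup>2"
          unfolding norm_w[symmetric] c_def
          unfolding power2_norm_eq_inner
          by (simp add: inner_add_left inner_add_right inner_commute algebra_simps power2_eq_square)
        finally show ?thesis
          using norm_split[of "t *\<^sub>R x" 1] x unfolding d_def
          by (simp add: power_mult_distrib algebra_simps)
      qed
      note * = this
      show ?thesis
      proof (rule ccontr)
        assume "w \<bullet> (C *v x) \<noteq> 0"
        then have c: "c\<^sup>2 > 0" by (simp add: c_def)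
        define m where "m = \<bar>d\<bar> + 1"
        have m: "m > 0" "d < 2 * m" by (auto simp: m_def)
        have "2 * (- c / m) * c + (- c / m)\<^sup>2 * d = c\<^sup>2 / m\<^sup>2 * (d - 2 * m)"
          using m by (simp add: power2_eq_square field_simps)
        also have "\<dots> < 0"
          using c m by (intro mult_pos_neg) auto
        finally show False
          using *[of "- c / m"] by simp
      qed
    qed
    define \<tau> where "\<tau> = K / s"
    define D where "D = (\<chi> i j. if j = k then \<tau> * C $ i $ j else C $ i $ j)"
    have "D = transpose (\<chi> j. if j = k then \<tau> *s (transpose C $ j) else transpose C $ j)"
      by (simp add: D_def vec_eq_iff transpose_def)
    then have det_D: "det D = \<tau> * det C"
      using det_row_mul[of k \<tau> "\<lambda>j. transpose C $ j" "\<lambda>j. transpose C $ j"] by simp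
    have "norm (D *v x) \<le> K * norm x" for x
    proof -
      define x' where "x' = x - (x $ k) *\<^sub>R axis k 1"
      have x': "x' $ k = 0" and x: "x = x' + (x $ k) *\<^sub>R axis k 1"
        by (simp_all add: x'_def)
      have "D *v x = C *v x' + (\<tau> * x $ k) *\<^sub>R w"
        unfolding x'_def w_def
        by (simp add: vec_eq_iff matrix_vector_mult_def D_def axis_def if_distrib if_distribR
            sum.remove[of UNIV k] algebra_simps cong: if_cong)
      then have "(norm (D *v x))\<^sup>2 = (norm (C *v x'))\<^sup>2 + (\<tau> * x $ k)\<^sup>2 * s\<^sup>2"
        using orth[OF x'] unfolding norm_w[symmetric] power2_norm_eq_inner
        by (simp add: inner_add_left inner_add_right inner_commute power2_eq_square)
      also have "\<dots> \<le> (K * norm x')\<^sup>2 + (\<tau> * x $ k)\<^sup>2 * s\<^sup>2"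
        by (intro add_right_mono power_mono C_upper) simp
      also have "\<dots> = K\<^sup>2 * ((norm x')\<^sup>2 + (x $ k)\<^sup>2)"
        using s_pos by (simp add: \<tau>_def field_simps)
      also have "\<dots> = (K * norm x)\<^sup>2"
        using norm_split[OF x', of "x $ k"] x by (simp add: power_mult_distrib)
      finally show ?thesis
        using K by (meson mult_nonneg_nonneg norm_ge_zero less_imp_le power2_le_imp_le)
    qed
    then have "\<bar>det D\<bar> \<le> K ^ ?N"
      by (rule abs_det_le_power[OF K])
    then have "K / s * \<bar>det B\<bar> \<le> K ^ ?N"
      using K s_pos by (simp add: det_D abs_mult det_C \<tau>_def)
    also have "K ^ ?N = K * K ^ (?N - 1)"
      by (simp flip: power_Suc)
    finally show ?thesis
      using K s_pos by (simp add: field_simps)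
  qed
  then have "\<bar>det B\<bar> * norm v \<le> K ^ (?N - 1) * s * norm v"
    by (intro mult_right_mono) auto
  also have "\<dots> \<le> K ^ (?N - 1) * norm (B *v v)"
    using s[of v] K by (simp add: mult.assoc mult_left_mono)
  finally show ?thesis .
qed

section \<open>Rotation invariance and sub-mean values\<close>

lemma nn_integral_lborel_add:
  fixes f :: "'a::euclidean_space \<Rightarrow> ennreal"
  assumes [measurable]: "f \<in> borel_measurable borel"
  shows "(\<integral>\<^sup>+x. f (c + x) \<partial>lborel) = (\<integral>\<^sup>+x. f x \<partial>lborel)"
  by (subst lborel_distr_plus[of c, symmetric], subst nn_integral_distr) simp_all

text \<open>
  The image measure \<open>\<nu>\<close> of Lebesgue measure under \<open>T\<close> is again translation invariant, and \<open>T\<close>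
  preserves the unit ball \<open>B\<close>. Integrating the indicator of \<open>{(x, y). x \<in> B \<and> x + y \<in> A}\<close> in both
  orders gives \<open>\<lambda>(B) \<nu>(A) = \<nu>(B) \<lambda>(A)\<close>, where \<open>\<lambda>\<close> is Lebesgue measure: this is the classical proof
  that Haar measure is unique, with the factor determined by \<open>B\<close>.
\<close>

lemma lborel_distr_orthogonal:
  fixes T :: "'a::euclidean_space \<Rightarrow> 'a"
  assumes T: "orthogonal_transformation T"
  shows "distr lborel borel T = lborel"
proof (rule measure_eqI)
  have lin: "linear T" using T by (rule orthogonal_transformation_linear)
  have [measurable]: "T \<in> borel_measurable borel"
    by (intro borel_measurable_continuous_onI linear_continuous_on linear_conv_bounded_linear[THEN iffD1] lin)
  define \<nu> where "\<nu> = distr lborel borel T"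
  have [measurable_cong]: "sets \<nu> = sets borel" by (simp add: \<nu>_def)
  have nu: "(\<integral>\<^sup>+x. f x \<partial>\<nu>) = (\<integral>\<^sup>+x. f (T x) \<partial>lborel)" if [measurable]: "f \<in> borel_measurable borel" for f
    unfolding \<nu>_def by (rule nn_integral_distr) auto
  have nu_add: "(\<integral>\<^sup>+x. f (c + x) \<partial>\<nu>) = (\<integral>\<^sup>+x. f x \<partial>\<nu>)" if [measurable]: "f \<in> borel_measurable borel" for f c
  proof -
    obtain d where d: "c = T d"
      using orthogonal_transformation_surj[OF T] by blast
    have "(\<integral>\<^sup>+x. f (c + x) \<partial>\<nu>) = (\<integral>\<^sup>+x. f (T (d + x)) \<partial>lborel)"
      by (subst nu) (auto simp: d linear_add[OF lin])
    also have "\<dots> = (\<integral>\<^sup>+x. f (T x) \<partial>lborel)"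
      by (rule nn_integral_lborel_add[of "\<lambda>x. f (T x)"]) simp
    finally show ?thesis by (simp add: nu)
  qed
  have nu_ball: "emeasure \<nu> (ball 0 r) = emeasure lborel (ball (0::'a) r)" for r
    by (simp add: \<nu>_def emeasure_distr vimage_def orthogonal_transformation_norm[OF T] ball_def)
  have sf: "sigma_finite_measure \<nu>"
  proof
    have "(\<Union>n. ball (0::'a) (real n)) = UNIV"
      using reals_Archimedean2 by (auto simp: dist_norm)
    then show "\<exists>A. countable A \<and> A \<subseteq> sets \<nu> \<and> \<Union> A = space \<nu> \<and> (\<forall>a\<in>A. emeasure \<nu> a \<noteq> \<infinity>)"
      by (intro exI[of _ "range (\<lambda>n. ball (0::'a) (real n))"])
         (use emeasure_lborel_ball_finite in \<open>auto simp: nu_ball less_top \<nu>_def[THEN arg_cong[where f=space]]\<close>)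
  qed
  interpret P: pair_sigma_finite lborel \<nu>
    using sf by (simp add: pair_sigma_finite_def sigma_finite_lborel)
  define B where "B = ball (0::'a) 1"
  have [measurable]: "B \<in> sets borel" by (simp add: B_def)
  have B_fin: "0 < emeasure lborel B" "emeasure lborel B < \<infinity>"
    by (auto simp: B_def emeasure_ball emeasure_lborel_ball_finite)
  fix A assume "A \<in> sets (distr lborel borel T)"
  then have [measurable]: "A \<in> sets borel" by simp
  have "emeasure lborel B * emeasure \<nu> A = (\<integral>\<^sup>+x. (\<integral>\<^sup>+y. indicator B x * indicator A y \<partial>\<nu>) \<partial>lborel)"
    by (simp add: nn_integral_cmult nn_integral_multc)
  also have "\<dots> = (\<integral>\<^sup>+x. (\<integral>\<^sup>+y. indicator B x * indicator A (x + y) \<partial>\<nu>) \<partial>lborel)"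
    by (intro nn_integral_cong nu_add[symmetric]) measurable
  also have "\<dots> = (\<integral>\<^sup>+y. (\<integral>\<^sup>+x. indicator B x * indicator A (x + y) \<partial>lborel) \<partial>\<nu>)"
    by (rule P.Fubini'[symmetric]) measurable
  also have "\<dots> = (\<integral>\<^sup>+y. (\<integral>\<^sup>+x. indicator B (x - y) * indicator A x \<partial>lborel) \<partial>\<nu>)"
  proof (rule nn_integral_cong)
    fix y
    show "(\<integral>\<^sup>+x. indicator B x * indicator A (x + y) \<partial>lborel) = (\<integral>\<^sup>+x. indicator B (x - y) * indicator A x \<partial>lborel :: ennreal)"
      using nn_integral_lborel_add[of "\<lambda>x. indicator B (x - y) * indicator A x" y] by (simp add: add.commute)
  qed
  also have "\<dots> = (\<integral>\<^sup>+x. (\<integral>\<^sup>+y. indicator B (x - y) * indicator A x \<partial>\<nu>) \<partial>lborel)"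
    by (rule P.Fubini') measurable
  also have "\<dots> = (\<integral>\<^sup>+x. emeasure lborel B * indicator A x \<partial>lborel)"
  proof (rule nn_integral_cong)
    fix x
    have "(\<integral>\<^sup>+y. indicator B (x - y) * indicator A x \<partial>\<nu>) = (\<integral>\<^sup>+y. indicator B (x - y) \<partial>\<nu>) * indicator A x"
      by (rule nn_integral_multc) measurable
    also have "(\<integral>\<^sup>+y. indicator B (x - y) \<partial>\<nu>) = (\<integral>\<^sup>+y. indicator B (x - (x + y)) \<partial>\<nu>)"
      by (rule nu_add[symmetric]) measurable
    also have "\<dots> = (\<integral>\<^sup>+y. indicator B y \<partial>\<nu>)"
      by (intro nn_integral_cong) (simp add: B_def indicator_def)
    also have "\<dots> = emeasure lborel B"
      by (simp add: B_def nu_ball)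
    finally show "(\<integral>\<^sup>+y. indicator B (x - y) * indicator A x \<partial>\<nu>) = emeasure lborel B * indicator A x" .
  qed
  also have "\<dots> = emeasure lborel B * emeasure lborel A"
    by (simp add: nn_integral_cmult)
  finally show "emeasure (distr lborel borel T) A = emeasure lborel A"
    using B_fin by (auto simp: \<nu>_def ennreal_mult_cancel_left)
qed simp

lemma norm_le_integral_circle:
  fixes f :: "complex \<Rightarrow> complex"
  assumes contf: "continuous_on (cball 0 1) f" and holf: "f holomorphic_on ball 0 1"
  shows "ennreal (2 * pi) * ennreal (norm (f 0)) \<le> (\<integral>\<^sup>+t. indicator {0..2 * pi} t * ennreal (norm (f (cis t))) \<partial>lborel)"
proof -
  have "((\<lambda>u. f u / (u - 0)) has_contour_integral (2 * of_real pi * \<i> * f 0)) (circlepath 0 1)"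
    using contf holf by (rule Cauchy_integral_circlepath) simp
  then have "((\<lambda>t. f (cis t) * \<i>) has_integral (2 * of_real pi * \<i> * f 0)) {0..2 * pi}"
    unfolding circlepath_def has_contour_integral_part_circlepath_iff[OF pi_gt_zero[THEN mult_pos_pos[OF zero_less_numeral]]]
    by simp
  from has_integral_mult_left[OF this, of "- \<i>"]
  have "((\<lambda>t. f (cis t)) has_integral (2 * of_real pi * \<i> * f 0 * - \<i>)) {0..2 * pi}"
    by (simp add: mult.assoc)
  also have "2 * of_real pi * \<i> * f 0 * - \<i> = 2 * pi * f 0"
    by (simp add: algebra_simps)
  finally have int: "((\<lambda>t. f (cis t)) has_integral (2 * pi * f 0)) {0..2 * pi}" .
  have cont: "continuous_on {0..2 * pi} (\<lambda>t. f (cis t))"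
    by (intro continuous_on_compose2[OF contf] continuous_intros) auto
  have "2 * pi * norm (f 0) = norm (2 * pi * f 0)"
    by (simp add: norm_mult)
  also have "\<dots> = norm (integral {0..2 * pi} (\<lambda>t. f (cis t)))"
    using int by (simp add: integral_unique)
  also have "\<dots> \<le> integral {0..2 * pi} (\<lambda>t. norm (f (cis t)))"
    by (intro integral_norm_bound_integral integrable_continuous_real cont continuous_on_norm) auto
  finally have "ennreal (2 * pi * norm (f 0)) \<le> ennreal (integral {0..2 * pi} (\<lambda>t. norm (f (cis t))))"
    by (rule ennreal_leI)
  also have "\<dots> = (\<integral>\<^sup>+t. ennreal (indicator {0..2 * pi} t * norm (f (cis t))) \<partial>lborel)"
    by (intro nn_integral_has_integral_lebesgue[symmetric] integrable_integral integrable_continuous_real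
        cont continuous_on_norm) auto
  also have "\<dots> = (\<integral>\<^sup>+t. indicator {0..2 * pi} t * ennreal (norm (f (cis t))) \<partial>lborel)"
    by (intro nn_integral_cong) (simp add: indicator_def)
  finally show ?thesis by (simp add: ennreal_mult)
qed

lemma norm_vector_smult: "norm (c *s v) = norm c * norm v" for v :: "complex^'n"
  by (simp add: norm_vec_def L2_set_def norm_mult power_mult_distrib real_sqrt_mult flip: sum_distrib_left)

lemma orthogonal_transformation_cis_smult: "orthogonal_transformation ((*s) (cis t) :: complex^'n \<Rightarrow> complex^'n)"
  unfolding orthogonal_transformation
  by (auto intro!: linearI simp: norm_vector_smult vec_eq_iff algebra_simps)

text \<open>
  Averaging the circle inequality over \<open>v\<close> in the ball of radius \<open>\<rho>\<close> and exchanging the integrals,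
  each rotation \<open>v \<mapsto> cis t *s v\<close> leaves the integral over the ball unchanged, so that the average over
  \<open>t\<close> disappears.
\<close>

lemma sub_mean_value_ball:
  fixes F :: "complex^'n \<Rightarrow> complex"
  assumes contF: "continuous_on (ball z \<rho>) F"
    and holF: "\<And>v. (\<lambda>t. F (z + t *s v)) holomorphic_on {t. z + t *s v \<in> ball z \<rho>}"
  shows "ennreal (norm (F z)) * emeasure lborel (ball z \<rho>) \<le> (\<integral>\<^sup>+w\<in>ball z \<rho>. ennreal (norm (F w)) \<partial>lborel)"
proof -
  define G where "G v = indicator (ball 0 \<rho>) v * ennreal (norm (F (z + v)))" for v
  have "(\<lambda>w. indicator (ball z \<rho>) w *\<^sub>R norm (F w)) \<in> borel_measurable borel"
    by (intro borel_measurable_continuous_on_indicator contF continuous_on_norm) auto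
  then have [measurable]: "(\<lambda>w. indicator (ball z \<rho>) w * norm (F w)) \<in> borel_measurable borel"
    by simp
  have G_alt: "G v = ennreal (indicator (ball z \<rho>) (z + v) * norm (F (z + v)))" for v
    by (simp add: G_def indicator_def dist_norm)
  have [measurable]: "G \<in> borel_measurable borel"
    unfolding G_alt[abs_def] by measurable
  have "continuous_on UNIV (\<lambda>x. cis (fst x) *s (snd x :: complex^'n))"
    unfolding vector_scalar_mult_def by (intro continuous_intros)
  then have [measurable]: "(\<lambda>x. cis (fst x) *s (snd x :: complex^'n)) \<in> borel \<Otimes>\<^sub>M borel \<rightarrow>\<^sub>M borel"
    unfolding borel_prod by (rule borel_measurable_continuous_onI)
  have [measurable]: "(\<lambda>v :: complex^'n. cis t *s v) \<in> borel_measurable borel" for t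
    unfolding vector_scalar_mult_def by (intro borel_measurable_continuous_onI continuous_intros)
  have rotate: "(\<integral>\<^sup>+v. G (cis t *s v) \<partial>lborel) = (\<integral>\<^sup>+v. G v \<partial>lborel)" for t
    by (subst (2) lborel_distr_orthogonal[OF orthogonal_transformation_cis_smult[of t], symmetric])
       (simp add: nn_integral_distr)
  have circle: "ennreal (2 * pi) * (ennreal (norm (F z)) * indicator (ball 0 \<rho>) v)
      \<le> (\<integral>\<^sup>+t. indicator {0..2 * pi} t * G (cis t *s v) \<partial>lborel)" for v
  proof (cases "v \<in> ball 0 \<rho>")
    case True
    have "norm t * norm v < \<rho>" if "norm t \<le> 1" for t :: complex
      using that True mult_right_mono[of "norm t" 1 "norm v"] by simp
    then have "cball 0 1 \<subseteq> {t. z + t *s v \<in> ball z \<rho>}"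
      by (auto simp: dist_norm norm_vector_smult)
    then have "(\<lambda>t. F (z + t *s v)) holomorphic_on cball 0 1"
      using holF[of v] holomorphic_on_subset by blast
    then have "ennreal (2 * pi) * ennreal (norm (F (z + 0 *s v))) \<le> (\<integral>\<^sup>+t. indicator {0..2 * pi} t * ennreal (norm (F (z + cis t *s v))) \<partial>lborel)"
      by (intro norm_le_integral_circle) (auto intro: holomorphic_on_imp_continuous_on holomorphic_on_subset)
    also have "\<dots> = (\<integral>\<^sup>+t. indicator {0..2 * pi} t * G (cis t *s v) \<partial>lborel)"
      using True by (intro nn_integral_cong) (simp add: G_def norm_vector_smult)
    finally show ?thesis using True by simp
  qed simp
  have "ennreal (2 * pi) * (ennreal (norm (F z)) * emeasure lborel (ball (0 :: complex^'n) \<rho>))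
      = (\<integral>\<^sup>+v. ennreal (2 * pi) * (ennreal (norm (F z)) * indicator (ball (0 :: complex^'n) \<rho>) v) \<partial>lborel)"
    by (simp only: nn_integral_cmult nn_integral_indicator borel_measurable_indicator
        borel_measurable_times_ennreal borel_measurable_const open_ball borel_open sets_lborel)
  also have "\<dots> \<le> (\<integral>\<^sup>+v. (\<integral>\<^sup>+t. indicator {0..2 * pi} t * G (cis t *s v) \<partial>lborel) \<partial>lborel)"
    by (intro nn_integral_mono circle)
  also have "\<dots> = (\<integral>\<^sup>+t. (\<integral>\<^sup>+v. indicator {0..2 * pi} t * G (cis t *s v) \<partial>lborel) \<partial>lborel)"
    by (rule lborel_pair.Fubini') measurable
  also have "\<dots> = (\<integral>\<^sup>+t. indicator {0..2 * pi} t * (\<integral>\<^sup>+v. G v \<partial>lborel) \<partial>lborel)"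
  proof (rule nn_integral_cong)
    fix t :: real
    have "(\<lambda>v. G (cis t *s v)) \<in> borel_measurable borel" by measurable
    then show "(\<integral>\<^sup>+v. indicator {0..2 * pi} t * G (cis t *s v) \<partial>lborel) = indicator {0..2 * pi} t * (\<integral>\<^sup>+v. G v \<partial>lborel)"
      by (simp add: nn_integral_cmult rotate)
  qed
  also have "\<dots> = ennreal (2 * pi) * (\<integral>\<^sup>+v. G v \<partial>lborel)"
    by (simp add: nn_integral_multc)
  also have "(\<integral>\<^sup>+v. G v \<partial>lborel) = (\<integral>\<^sup>+w. ennreal (indicator (ball z \<rho>) w * norm (F w)) \<partial>lborel)"
    unfolding G_alt by (rule nn_integral_lborel_add) measurable
  also have "\<dots> = (\<integral>\<^sup>+w\<in>ball z \<rho>. ennreal (norm (F w)) \<partial>lborel)"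
    by (intro nn_integral_cong) (simp add: indicator_def)
  finally have le: "ennreal (norm (F z)) * emeasure lborel (ball (0 :: complex^'n) \<rho>) \<le> (\<integral>\<^sup>+w\<in>ball z \<rho>. ennreal (norm (F w)) \<partial>lborel)"
    by (rule ennreal_mult_le_mult_iff[THEN iffD1, rotated 2]) simp_all
  have eq: "emeasure lborel (ball (0 :: complex^'n) \<rho>) = emeasure lborel (ball z \<rho>)"
  proof (cases "\<rho> \<ge> 0")
    case True
    then show ?thesis by (simp only: emeasure_ball)
  next
    case False
    then have "ball (0 :: complex^'n) \<rho> = {}" "ball z \<rho> = {}" by auto
    then show ?thesis by (simp only: emeasure_empty)
  qed
  show ?thesis
    using le unfolding eq .
qed

section \<open>Holomorphic functions on complex lines\<close>

text \<open>
  A continuous function that is holomorphic along every complex line is holomorphic in the usual sense.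
  This form of the notion is closed under the algebraic operations and reduces every argument
  about several variables below to the theory of one variable.
\<close>

definition line_holomorphic_on :: "(complex^'n \<Rightarrow> complex) \<Rightarrow> (complex^'n) set \<Rightarrow> bool"
  where "line_holomorphic_on F S \<longleftrightarrow>
    continuous_on S F \<and> (\<forall>a b. (\<lambda>t. F (a + t *s b)) holomorphic_on {t. a + t *s b \<in> S})"

lemma line_holomorphic_on_const [simp]: "line_holomorphic_on (\<lambda>_. c) S"
  by (simp add: line_holomorphic_on_def)

lemma line_holomorphic_on_add:
  "line_holomorphic_on F S \<Longrightarrow> line_holomorphic_on G S \<Longrightarrow> line_holomorphic_on (\<lambda>z. F z + G z) S"
  by (auto simp: line_holomorphic_on_def intro!: continuous_on_add holomorphic_on_add)

lemma line_holomorphic_on_mult: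
  "line_holomorphic_on F S \<Longrightarrow> line_holomorphic_on G S \<Longrightarrow> line_holomorphic_on (\<lambda>z. F z * G z) S"
  by (auto simp: line_holomorphic_on_def intro!: continuous_on_mult holomorphic_on_mult)

lemma line_holomorphic_on_divide:
  "line_holomorphic_on F S \<Longrightarrow> line_holomorphic_on G S \<Longrightarrow> (\<And>z. z \<in> S \<Longrightarrow> G z \<noteq> 0)
    \<Longrightarrow> line_holomorphic_on (\<lambda>z. F z / G z) S"
  by (auto simp: line_holomorphic_on_def intro!: continuous_on_divide holomorphic_on_divide)

lemma line_holomorphic_on_power:
  "line_holomorphic_on F S \<Longrightarrow> line_holomorphic_on (\<lambda>z. F z ^ m) S"
  by (auto simp: line_holomorphic_on_def intro!: continuous_on_power holomorphic_on_power)

lemma line_holomorphic_on_sum: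
  "(\<And>i. i \<in> I \<Longrightarrow> line_holomorphic_on (F i) S) \<Longrightarrow> line_holomorphic_on (\<lambda>z. \<Sum>i\<in>I. F i z) S"
  by (auto simp: line_holomorphic_on_def intro!: continuous_on_sum holomorphic_on_sum)

lemma line_holomorphic_on_prod:
  "(\<And>i. i \<in> I \<Longrightarrow> line_holomorphic_on (F i) S) \<Longrightarrow> line_holomorphic_on (\<lambda>z. \<Prod>i\<in>I. F i z) S"
  by (auto simp: line_holomorphic_on_def intro!: continuous_on_prod holomorphic_on_prod)

lemma line_holomorphic_on_subset:
  assumes "line_holomorphic_on F S" "T \<subseteq> S"
  shows "line_holomorphic_on F T"
  unfolding line_holomorphic_on_def
proof (intro conjI allI)
  show "continuous_on T F"
    using assms continuous_on_subset by (auto simp: line_holomorphic_on_def)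
  show "(\<lambda>t. F (a + t *s b)) holomorphic_on {t. a + t *s b \<in> T}" for a b
    using assms by (auto simp: line_holomorphic_on_def intro: holomorphic_on_subset)
qed

lemma line_holomorphic_on_cong:
  assumes "\<And>z. z \<in> S \<Longrightarrow> F z = G z"
  shows "line_holomorphic_on F S \<longleftrightarrow> line_holomorphic_on G S"
  unfolding line_holomorphic_on_def
  using assms by (intro arg_cong2[where f="(\<and>)"] continuous_on_cong all_cong1 holomorphic_cong) auto

lemma line_holomorphic_on_det:
  fixes A :: "complex^'n \<Rightarrow> complex^'m^'m"
  assumes "\<And>i j. line_holomorphic_on (\<lambda>z. A z $ i $ j) S"
  shows "line_holomorphic_on (\<lambda>z. det (A z)) S"
  unfolding det_def
  by (intro line_holomorphic_on_sum line_holomorphic_on_mult line_holomorphic_on_prod line_holomorphic_on_const assms)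

text \<open>
  Difference quotients converge at a rate that depends on the bound of the function alone: Cauchy's
  inequality bounds the second derivative on the disc of half the radius, and Taylor's theorem does the
  rest.
\<close>

lemma slope_deriv_bound:
  fixes \<phi> :: "complex \<Rightarrow> complex"
  assumes hol: "\<phi> holomorphic_on U" and U: "open U" "cball 0 \<rho> \<subseteq> U"
    and bd: "\<And>s. norm s \<le> \<rho> \<Longrightarrow> norm (\<phi> s) \<le> M"
    and \<rho>: "\<rho> > 0" and s: "s \<noteq> 0" "norm s \<le> \<rho> / 2"
  shows "norm ((\<phi> s - \<phi> 0) / s - deriv \<phi> 0) \<le> 8 * M / \<rho>\<^sup>2 * norm s"
proof -
  have "norm (deriv (deriv \<phi>) w) \<le> 8 * M / \<rho>\<^sup>2" if w: "w \<in> cball 0 (\<rho> / 2)" for w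
  proof -
    have near: "norm x \<le> \<rho>" if "norm (w - x) \<le> \<rho> / 2" for x
      using w that norm_triangle_ineq4[of w "w - x"] by simp
    then have sub: "cball w (\<rho> / 2) \<subseteq> U" "ball w (\<rho> / 2) \<subseteq> U"
      using U by (auto simp: dist_norm subset_iff)
    have "norm ((deriv ^^ 2) \<phi> w) \<le> fact 2 * M / (\<rho> / 2) ^ 2"
    proof (rule Cauchy_inequality)
      show "\<phi> holomorphic_on ball w (\<rho> / 2)" "continuous_on (cball w (\<rho> / 2)) \<phi>"
        using hol sub by (meson holomorphic_on_subset holomorphic_on_imp_continuous_on)+
    qed (use near bd \<rho> in auto)
    then show ?thesis by (simp add: numeral_2_eq_2 power2_eq_square)
  qed
  then have "norm ((\<lambda>i. (deriv ^^ i) \<phi>) 0 s - (\<Sum>i\<le>1. (deriv ^^ i) \<phi> 0 * (s - 0) ^ i / fact i))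
      \<le> 8 * M / \<rho>\<^sup>2 * norm (s - 0) ^ Suc 1 / fact 1"
  proof (intro complex_Taylor[where S="cball 0 (\<rho> / 2)"])
    fix i x assume "x \<in> cball (0::complex) (\<rho> / 2)"
    then have "x \<in> U" using U \<rho> by (auto simp: subset_iff)
    then have "((deriv ^^ i) \<phi> has_field_derivative (deriv ^^ Suc i) \<phi> x) (at x)"
      using hol U by (auto intro!: holomorphic_derivI holomorphic_higher_deriv)
    then show "((deriv ^^ i) \<phi> has_field_derivative (deriv ^^ Suc i) \<phi> x) (at x within cball 0 (\<rho> / 2))"
      by (rule has_field_derivative_at_within)
  qed (use s \<rho> in auto)
  then have "norm (\<phi> s - (\<phi> 0 + deriv \<phi> 0 * s)) \<le> 8 * M / \<rho>\<^sup>2 * norm s * norm s"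
    by (simp add: power2_eq_square)
  moreover have "(\<phi> s - \<phi> 0) / s - deriv \<phi> 0 = (\<phi> s - (\<phi> 0 + deriv \<phi> 0 * s)) / s"
    using s by (simp add: field_simps)
  ultimately show ?thesis
    using s by (simp add: norm_divide divide_le_eq)
qed

lemma norm_add_smult_le: "norm (a + t *s b) \<le> norm a + norm t * norm b" for a b :: "complex^'n"
  using norm_triangle_ineq[of a "t *s b"] by (simp add: norm_vector_smult)

lemma open_line_vimage:
  fixes a b :: "complex^'n"
  assumes "open S"
  shows "open {t. a + t *s b \<in> S}"
proof -
  have "continuous_on UNIV (\<lambda>t. a + t *s b)"
    unfolding vector_scalar_mult_def by (intro continuous_intros)
  then have "open ((\<lambda>t. a + t *s b) -` S)"
    using assms open_vimage by blast
  then show ?thesis by (simp add: vimage_def)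
qed

text \<open>
  Near a point of \<open>S\<close> the function \<open>F\<close> is bounded, so that the difference quotients in the direction
  \<open>u\<close>, taken along a fixed null sequence, converge uniformly. Each of them is continuous and
  holomorphic along lines, and both properties pass to uniform limits. It follows that the entries of a
  complex Jacobian matrix are holomorphic, although Frechet differentiability says nothing about
  the continuity of the derivative.
\<close>

lemma line_holomorphic_on_directional_deriv:
  fixes F :: "complex^'n \<Rightarrow> complex"
  assumes F: "line_holomorphic_on F S" and S: "open S"
  shows "line_holomorphic_on (\<lambda>z. deriv (\<lambda>s. F (z + s *s u)) 0) S"
proof -
  define G where "G z = deriv (\<lambda>s. F (z + s *s u)) 0" for z
  have local: "\<exists>r. \<exists>\<sigma> :: nat \<Rightarrow> complex. r > 0 \<and> cball z0 r \<subseteq> S \<and> (\<forall>n. \<sigma> n \<noteq> 0) \<and> (\<forall>n. \<forall>z\<in>cball z0 r. z + \<sigma> n *s u \<in> S) \<and>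
    uniform_limit (cball z0 r) (\<lambda>n z. (F (z + \<sigma> n *s u) - F z) / \<sigma> n) G sequentially" if z0: "z0 \<in> S" for z0
  proof -
    obtain r' where r': "r' > 0" "cball z0 r' \<subseteq> S"
      using S z0 open_contains_cball by blast
    define r where "r = r' / 2"
    have r: "r > 0" "cball z0 (2 * r) \<subseteq> S" using r' by (auto simp: r_def)
    \<comment> \<open>The summand \<open>1\<close> keeps the quotient meaningful for \<open>u = 0\<close>.\<close>
    define \<rho> where "\<rho> = r / (norm u + 1)"
    have \<rho>: "\<rho> > 0" "\<rho> * norm u \<le> r" using r by (auto simp: \<rho>_def field_simps add_pos_nonneg)
    have "bounded (F ` cball z0 (2 * r))"
      using F r by (intro compact_imp_bounded compact_continuous_image)
        (auto simp: line_holomorphic_on_def intro: continuous_on_subset)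
    then obtain M where M: "\<And>z. z \<in> cball z0 (2 * r) \<Longrightarrow> norm (F z) \<le> M"
      unfolding bounded_iff by (meson imageI)
    have shift: "z + s *s u \<in> cball z0 (2 * r)" if z: "z \<in> cball z0 r" and s: "norm s \<le> \<rho>" for z s
    proof -
      have "norm ((z - z0) + s *s u) \<le> norm (z - z0) + norm s * norm u"
        by (rule norm_add_smult_le)
      also have "\<dots> \<le> r + \<rho> * norm u"
        using z s by (intro add_mono mult_right_mono) (auto simp: dist_norm norm_minus_commute)
      finally show ?thesis
        using \<rho> by (simp add: dist_norm norm_minus_commute algebra_simps)
    qed
    define \<sigma> where "\<sigma> n = complex_of_real (\<rho> / 2 * inverse (real (Suc n)))" for n
    have norm_\<sigma>: "norm (\<sigma> n) = \<rho> / 2 * inverse (real (Suc n))" for n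
      using \<rho> by (simp add: \<sigma>_def norm_mult norm_inverse norm_divide del: of_nat_Suc)
    have \<sigma>: "\<sigma> n \<noteq> 0" "norm (\<sigma> n) \<le> \<rho> / 2" for n
    proof -
      show "\<sigma> n \<noteq> 0" using \<rho> norm_\<sigma>[of n] by auto
      have "inverse (real (Suc n)) \<le> 1" by (simp add: inverse_le_1_iff)
      from mult_left_mono[OF this, of "\<rho> / 2"] show "norm (\<sigma> n) \<le> \<rho> / 2" 
        using \<rho> unfolding norm_\<sigma> by simp
    qed
    have est: "norm ((F (z + \<sigma> n *s u) - F z) / \<sigma> n - G z) \<le> 8 * M / \<rho>\<^sup>2 * norm (\<sigma> n)" if z: "z \<in> cball z0 r" for z n
    proof -
      have "norm ((F (z + \<sigma> n *s u) - F (z + 0 *s u)) / \<sigma> n - deriv (\<lambda>s. F (z + s *s u)) 0) \<le> 8 * M / \<rho>\<^sup>2 * norm (\<sigma> n)"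
      proof (rule slope_deriv_bound)
        show "(\<lambda>s. F (z + s *s u)) holomorphic_on {s. z + s *s u \<in> S}"
          using F by (simp add: line_holomorphic_on_def)
        show "cball 0 \<rho> \<subseteq> {s. z + s *s u \<in> S}"
          using shift[OF z] r by auto
      qed (use open_line_vimage[OF S] M shift[OF z] \<rho> \<sigma> in auto)
      then show ?thesis by (simp add: G_def)
    qed
    have "uniform_limit (cball z0 r) (\<lambda>n z. (F (z + \<sigma> n *s u) - F z) / \<sigma> n) G sequentially"
    proof (rule uniform_limitI)
      fix e :: real assume "e > 0"
      have "(\<lambda>n. 8 * M / \<rho>\<^sup>2 * norm (\<sigma> n)) \<longlonglongrightarrow> 8 * M / \<rho>\<^sup>2 * (\<rho> / 2 * 0)"
        unfolding norm_\<sigma> by (intro tendsto_mult tendsto_const LIMSEQ_inverse_real_of_nat)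
      then have "\<forall>\<^sub>F n in sequentially. 8 * M / \<rho>\<^sup>2 * norm (\<sigma> n) < e"
        using \<open>e > 0\<close> by (intro order_tendstoD) auto
      then show "\<forall>\<^sub>F n in sequentially. \<forall>z\<in>cball z0 r. dist ((F (z + \<sigma> n *s u) - F z) / \<sigma> n) (G z) < e"
      proof eventually_elim
        case (elim n)
        then show ?case
          unfolding dist_norm using est le_less_trans by blast
      qed
    qed
    moreover have "z + \<sigma> n *s u \<in> S" if "z \<in> cball z0 r" for z n
      using shift[OF that, of "\<sigma> n"] \<sigma>[of n] \<rho> r by auto
    moreover have "cball z0 r \<subseteq> S" using r by auto
    ultimately show ?thesis using r \<sigma> by blast
  qed
  have contF: "continuous_on S F" and holF: "(\<lambda>t. F (a + t *s b)) holomorphic_on {t. a + t *s b \<in> S}" for a b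
    using F by (auto simp: line_holomorphic_on_def)
  have shift_cont: "continuous_on X (\<lambda>z. z + s *s u)" for X s
    by (intro continuous_intros)
  have "isCont G z0" if z0: "z0 \<in> S" for z0
  proof -
    obtain r \<sigma> where r: "r > 0" "cball z0 r \<subseteq> S"
      and \<sigma>0: "\<forall>n. \<sigma> n \<noteq> 0" and \<sigma>: "\<forall>n. \<forall>z\<in>cball z0 r. z + \<sigma> n *s u \<in> S"
      and lim: "uniform_limit (cball z0 r) (\<lambda>n z. (F (z + \<sigma> n *s u) - F z) / \<sigma> n) G sequentially"
      using local[OF z0] by (elim exE conjE) (rule that)
    have "continuous_on (cball z0 r) (\<lambda>z. (F (z + \<sigma> n *s u) - F z) / \<sigma> n)" for n
      using r \<sigma>0 \<sigma> by (intro continuous_on_divide continuous_on_diff continuous_on_const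
          continuous_on_compose2[OF contF shift_cont] continuous_on_subset[OF contF]) auto
    then have "continuous_on (cball z0 r) G"
      by (intro uniform_limit_theorem[OF _ lim] always_eventually) auto
    then show ?thesis
      using r continuous_on_interior[of "cball z0 r" G z0] by (simp add: interior_cball)
  qed
  then have "continuous_on S G"
    by (intro continuous_at_imp_continuous_on) auto
  moreover have "(\<lambda>t. G (a + t *s b)) holomorphic_on {t. a + t *s b \<in> S}" for a b
  proof (rule holomorphic_on_open[OF open_line_vimage[OF S], THEN iffD2], rule ballI)
    fix t0 assume "t0 \<in> {t. a + t *s b \<in> S}"
    then have t0: "a + t0 *s b \<in> S" by simp
    from local[OF t0] obtain r \<sigma> where r: "r > 0" "cball (a + t0 *s b) r \<subseteq> S"
      and \<sigma>0: "\<forall>n. \<sigma> n \<noteq> 0" and \<sigma>: "\<forall>n. \<forall>z\<in>cball (a + t0 *s b) r. z + \<sigma> n *s u \<in> S"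
      and lim: "uniform_limit (cball (a + t0 *s b) r) (\<lambda>n z. (F (z + \<sigma> n *s u) - F z) / \<sigma> n) G sequentially"
      by (elim exE conjE) (rule that)
    define d where "d = r / (norm b + 1)"
    have d: "d > 0" "d * norm b \<le> r" using r by (auto simp: d_def field_simps add_pos_nonneg)
    have in_ball: "a + t *s b \<in> cball (a + t0 *s b) r" if "t \<in> cball t0 d" for t
    proof -
      have "dist (a + t0 *s b) (a + t *s b) = norm (t0 - t) * norm b"
        unfolding dist_norm norm_vector_smult[symmetric] vector_sub_rdistrib by simp
      also have "\<dots> \<le> d * norm b"
        using that by (intro mult_right_mono) (auto simp: dist_norm)
      finally show ?thesis using d by simp
    qed
    have hol: "(\<lambda>t. (F (a + t *s b + \<sigma> n *s u) - F (a + t *s b)) / \<sigma> n) holomorphic_on cball t0 d" for n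
    proof (intro holomorphic_intros)
      show "(\<lambda>t. F (a + t *s b)) holomorphic_on cball t0 d"
        using in_ball r by (intro holomorphic_on_subset[OF holF]) auto
      have swap: "a + t *s b + \<sigma> n *s u = (a + \<sigma> n *s u) + t *s b" for t
        by (simp only: ac_simps)
      have "cball t0 d \<subseteq> {t. (a + \<sigma> n *s u) + t *s b \<in> S}"
        using in_ball \<sigma> unfolding swap[symmetric] by blast
      then show "(\<lambda>t. F (a + t *s b + \<sigma> n *s u)) holomorphic_on cball t0 d"
        unfolding swap by (rule holomorphic_on_subset[OF holF])
      show "\<sigma> n \<noteq> 0" using \<sigma>0 by simp
    qed
    define K where "K n t = (F (a + t *s b + \<sigma> n *s u) - F (a + t *s b)) / \<sigma> n" for n t
    have "uniform_limit (cball t0 d) K (\<lambda>t. G (a + t *s b)) sequentially"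
      unfolding K_def[abs_def] by (rule uniform_limit_compose'[OF lim]) (use in_ball in blast)
    moreover have hol_K: "K n holomorphic_on cball t0 d" for n
      unfolding K_def[abs_def] by (rule hol)
    have "\<forall>\<^sub>F n in sequentially. continuous_on (cball t0 d) (K n) \<and> K n holomorphic_on ball t0 d"
      by (intro always_eventually allI conjI holomorphic_on_imp_continuous_on hol_K
          holomorphic_on_subset[OF hol_K ball_subset_cball])
    ultimately have "(\<lambda>t. G (a + t *s b)) holomorphic_on ball t0 d"
      by (rule_tac holomorphic_uniform_limit[of t0 d K sequentially "\<lambda>t. G (a + t *s b)"]) (simp_all only: trivial_limit_sequentially not_False_eq_True)
    then have "(\<lambda>t. G (a + t *s b)) field_differentiable at t0"
      by (rule holomorphic_on_imp_differentiable_at[OF _ open_ball]) (simp add: d)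
    then show "\<exists>f'. ((\<lambda>t. G (a + t *s b)) has_field_derivative f') (at t0)"
      unfolding field_differentiable_def .

  qed
  ultimately show ?thesis
    by (simp add: line_holomorphic_on_def G_def[abs_def])
qed

lemma smult_axis: "axis k w = w *s axis k (1::complex)"
  by (simp add: vec_eq_iff axis_def)

lemma matrix_vector_mult_axis: "(A *v axis k 1) $ j = A $ j $ k" for A :: "complex^'n^'m"
  by (simp add: matrix_vector_mult_def axis_def if_distrib cong: if_cong)

lemma has_derivative_complex_jacobian:
  fixes h :: "complex^'n \<Rightarrow> complex^'n"
  assumes "holomorphic_map_on h S" "z \<in> S"
  shows "(h has_derivative (\<lambda>v. complex_jacobian h z *v v)) (at z)"
    and "((\<lambda>t. h (z + t *s b) $ j) has_field_derivative (complex_jacobian h z *v b) $ j) (at 0)"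
proof -
  obtain A :: "complex^'n^'n" where A: "(h has_derivative (\<lambda>v. A *v v)) (at z)"
    using assms by (auto simp: holomorphic_map_on_def)
  have der: "((\<lambda>t. h (z + t *s b) $ j) has_field_derivative (A *v b) $ j) (at 0)" for b j
  proof -
    have "bounded_linear (\<lambda>t::complex. t *s b)"
      by (intro linear_conv_bounded_linear[THEN iffD1] linearI) (simp_all add: vec_eq_iff algebra_simps)
    then have "((\<lambda>t. t *s b) has_derivative (\<lambda>t. t *s b)) (at 0)"
      by (rule bounded_linear_imp_has_derivative)
    from has_derivative_add[OF has_derivative_const[of z] this]
    have "((\<lambda>t. z + t *s b) has_derivative (\<lambda>t. t *s b)) (at 0)"
      by simp
    moreover have "(h has_derivative (\<lambda>v. A *v v)) (at (z + 0 *s b))"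
      using A by simp
    ultimately have "((\<lambda>t. h (z + t *s b)) has_derivative (\<lambda>t. A *v (t *s b))) (at 0)"
      by (rule has_derivative_compose)
    then have "((\<lambda>t. h (z + t *s b) $ j) has_derivative (\<lambda>t. (A *v (t *s b)) $ j)) (at 0)"
      by (rule bounded_linear.has_derivative[OF bounded_linear_vec_nth])
    moreover have "(\<lambda>t. (A *v (t *s b)) $ j) = (*) ((A *v b) $ j)"
      by (rule ext) (simp add: vector_scalar_commute)
    ultimately show ?thesis
      unfolding has_field_derivative_def by (simp only:)
  qed
  have "complex_jacobian h z $ j $ k = A $ j $ k" for j k
  proof -
    have "((\<lambda>w. h (z + axis k w) $ j) has_field_derivative A $ j $ k) (at 0)"
      using der[of "axis k 1" j] unfolding smult_axis[symmetric] matrix_vector_mult_axis .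
    then show ?thesis unfolding complex_jacobian_def vec_lambda_beta by (rule DERIV_imp_deriv)
  qed
  then have "complex_jacobian h z = A" by (simp add: vec_eq_iff)
  with A der[of b j] show "(h has_derivative (\<lambda>v. complex_jacobian h z *v v)) (at z)"
    "((\<lambda>t. h (z + t *s b) $ j) has_field_derivative (complex_jacobian h z *v b) $ j) (at 0)"
    by (simp_all only:)
qed

lemma line_holomorphic_on_component:
  fixes h :: "complex^'n \<Rightarrow> complex^'n"
  assumes h: "holomorphic_map_on h S"
  shows "line_holomorphic_on (\<lambda>z. h z $ j) S"
  unfolding line_holomorphic_on_def
proof (intro conjI allI)
  have S: "open S" using h by (simp add: holomorphic_map_on_def)
  have "continuous_on S h"
    by (auto intro!: continuous_at_imp_continuous_on has_derivative_continuous
        has_derivative_complex_jacobian(1)[OF h])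
  then show "continuous_on S (\<lambda>z. h z $ j)" by (rule bounded_linear.continuous_on[OF bounded_linear_vec_nth])
  show "(\<lambda>t. h (a + t *s b) $ j) holomorphic_on {t. a + t *s b \<in> S}" for a b
  proof (rule holomorphic_on_open[OF open_line_vimage[OF S], THEN iffD2], rule ballI)
    fix t0 assume "t0 \<in> {t. a + t *s b \<in> S}"
    then have t0: "a + t0 *s b \<in> S" by simp
    have shift: "a + (t + t0) *s b = a + t0 *s b + t *s b" for t
      by (simp add: vector_sadd_rdistrib)
    have "((\<lambda>t. h (a + (t + t0) *s b) $ j) has_field_derivative (complex_jacobian h (a + t0 *s b) *v b) $ j) (at 0)"
      unfolding shift by (rule has_derivative_complex_jacobian(2)[OF h t0])
    then have "((\<lambda>t. h (a + t *s b) $ j) has_field_derivative (complex_jacobian h (a + t0 *s b) *v b) $ j) (at (0 + t0))"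
      by (rule DERIV_shift[THEN iffD2])
    then show "\<exists>f'. ((\<lambda>t. h (a + t *s b) $ j) has_field_derivative f') (at t0)"
      by auto
  qed
qed

lemma line_holomorphic_on_complex_jacobian:
  fixes h :: "complex^'n \<Rightarrow> complex^'n"
  assumes h: "holomorphic_map_on h S"
  shows "line_holomorphic_on (\<lambda>z. complex_jacobian h z $ j $ k) S"
  using line_holomorphic_on_directional_deriv[OF line_holomorphic_on_component[OF h], where u = "axis k 1"] h
  by (simp add: complex_jacobian_def smult_axis[symmetric] holomorphic_map_on_def)

section \<open>Vector-valued Schwarz lemma and subharmonicity\<close>

lemma norm_sum_cnj_mult_le:
  fixes c x :: "complex^'n"
  shows "norm (\<Sum>j\<in>UNIV. cnj (c $ j) * x $ j) \<le> norm c * norm x"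
proof -
  have "norm (\<Sum>j\<in>UNIV. cnj (c $ j) * x $ j) \<le> (\<Sum>j\<in>UNIV. \<bar>norm (c $ j)\<bar> * \<bar>norm (x $ j)\<bar>)"
    by (rule sum_norm_le) (simp add: norm_mult)
  also have "\<dots> \<le> norm c * norm x"
    unfolding norm_vec_def by (rule L2_set_mult_ineq)
  finally show ?thesis .
qed

lemma sum_cnj_mult_self: "(\<Sum>j\<in>UNIV. cnj (c $ j) * c $ j) = of_real ((norm c)\<^sup>2)" for c :: "complex^'n"
  by (simp add: norm_vec_def L2_set_def sum_nonneg complex_norm_square mult.commute del: of_real_power)

text \<open>
  Only the weak inequality \<open>norm (f s) \<le> B\<close> is assumed, as it is what operator norms provide; dividing
  by \<open>B + e\<close> instead of \<open>B\<close> makes it strict and covers \<open>B = 0\<close>.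
\<close>

lemma Schwarz_Lemma_scaled:
  fixes f :: "complex \<Rightarrow> complex"
  assumes hol: "f holomorphic_on ball 0 r" and f0: "f 0 = 0"
    and bd: "\<And>s. norm s < r \<Longrightarrow> norm (f s) \<le> B" and t: "norm t < r"
  shows "norm (f t) \<le> B * norm t / r"
proof (rule field_le_epsilon)
  fix e :: real assume e: "e > 0"
  have r: "r > 0" using t norm_ge_zero[of t] by linarith
  have B: "B \<ge> 0" using bd[of 0] r f0 by simp
  define F where "F s = f (of_real r * s) / of_real (B + e)" for s
  have in_ball: "norm (of_real r * s) < r" if "norm s < 1" for s :: complex
    using that r by (simp add: norm_mult)
  have "norm (F (t / of_real r)) \<le> norm (t / of_real r)"
  proof (rule Schwarz_Lemma(1))
    have "(\<lambda>s. f (of_real r * s)) holomorphic_on ball 0 1"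
      by (rule holomorphic_on_compose_gen[OF _ hol, unfolded o_def])
         (use in_ball in \<open>auto intro!: holomorphic_intros\<close>)
    then show "F holomorphic_on ball 0 1"
      unfolding F_def using B e by (intro holomorphic_on_divide holomorphic_on_const) (auto simp del: of_real_add)
    show "norm (F s) < 1" if "norm s < 1" for s
    proof -
      have "norm (f (of_real r * s)) < B + e" using bd[OF in_ball[OF that]] e by linarith
      then show ?thesis using B e by (simp add: F_def norm_divide del: of_real_add)
    qed
    show "norm (t / of_real r) < 1" using t r by (simp add: norm_divide)
  qed (simp add: F_def f0)
  then have "norm (f t) \<le> (B + e) * (norm t / r)"
    using B e r by (simp add: F_def norm_divide divide_le_eq mult.commute del: of_real_add)
  also have "\<dots> \<le> B * norm t / r + e"
    using t r e by (simp add: field_simps)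
  finally show "norm (f t) \<le> B * norm t / r + e" .
qed

text \<open>
  Pairing \<open>W\<close> along the complex line through \<open>z\<close> with the fixed vector \<open>W z\<close> yields a scalar function
  that is as large as possible at \<open>z\<close>.
\<close>

lemma Schwarz_Lemma_vector:
  fixes W :: "complex^'n \<Rightarrow> complex^'m"
  assumes W: "\<And>j. line_holomorphic_on (\<lambda>z. W z $ j) (ball 0 R)" and W0: "W 0 = 0"
    and bd: "\<And>z. norm z < R \<Longrightarrow> norm (W z) \<le> B" and z: "norm z < R"
  shows "norm (W z) \<le> B * norm z / R"
proof (cases "z = 0 \<or> W z = 0")
  case True
  have R: "R > 0" using z norm_ge_zero[of z] by linarith
  have "B \<ge> 0" using bd[of 0] R W0 by simp
  then show ?thesis using True W0 R by auto
next
  case False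
  have R: "R > 0" using z norm_ge_zero[of z] by linarith
  define c where "c = W z"
  have c: "norm c > 0" using False by (simp add: c_def)
  define f where "f t = (\<Sum>j\<in>UNIV. cnj (c $ j) * W (t *s z) $ j)" for t
  have in_ball: "norm (t *s z) < R" if "norm t < R / norm z" for t
    using that False by (simp add: norm_vector_smult field_simps)
  \<comment> \<open>The line is parametrized by \<open>t *s z\<close>; it meets the ball in the disc of radius \<open>R / norm z\<close>, and
    \<open>z\<close> is its value at \<open>1\<close>.\<close>
  have "norm (f 1) \<le> (norm c * B) * norm (1 :: complex) / (R / norm z)"
  proof (rule Schwarz_Lemma_scaled)
    have "line_holomorphic_on (\<lambda>w. \<Sum>j\<in>UNIV. cnj (c $ j) * W w $ j) (ball 0 R)"
      by (intro line_holomorphic_on_sum line_holomorphic_on_mult line_holomorphic_on_const W)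
    then have "(\<lambda>t. \<Sum>j\<in>UNIV. cnj (c $ j) * W (0 + t *s z) $ j) holomorphic_on {t. 0 + t *s z \<in> ball 0 R}"
      unfolding line_holomorphic_on_def by blast
    then have "f holomorphic_on {t. t *s z \<in> ball 0 R}"
      by (simp add: f_def[abs_def])
    then show "f holomorphic_on ball 0 (R / norm z)"
      by (rule holomorphic_on_subset) (use in_ball in auto)
    show "f 0 = 0" by (simp add: f_def W0)
    show "norm (f s) \<le> norm c * B" if "norm s < R / norm z" for s
    proof -
      have "norm (f s) \<le> norm c * norm (W (s *s z))"
        unfolding f_def by (rule norm_sum_cnj_mult_le)
      also have "\<dots> \<le> norm c * B"
        by (intro mult_left_mono bd in_ball that) simp
      finally show ?thesis .
    qed
    show "norm (1 :: complex) < R / norm z" using z False by simp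
  qed
  moreover have "norm (f 1) = norm c * norm c"
    by (simp add: f_def sum_cnj_mult_self flip: c_def) (simp add: power2_eq_square norm_mult)
  ultimately have "norm c * norm c \<le> norm c * (B * norm z / R)"
    by simp
  then show ?thesis
    using c unfolding c_def by (rule mult_left_le_imp_le)
qed

text \<open>
  The power of the norm is subharmonic because at \<open>z\<close> it agrees with the modulus of the holomorphic
  function \<open>F\<close>, the power of the pairing with the unit vector in the direction of \<open>W z\<close>, and dominates
  that modulus elsewhere.
\<close>

lemma sub_mean_value_norm_power:
  fixes W :: "complex^'n \<Rightarrow> complex^'m"
  assumes W: "\<And>j. line_holomorphic_on (\<lambda>z. W z $ j) (ball z \<rho>)" and m: "m > 0"
  shows "ennreal (norm (W z) ^ m) * emeasure lborel (ball z \<rho>) \<le> (\<integral>\<^sup>+w\<in>ball z \<rho>. ennreal (norm (W w) ^ m) \<partial>lborel)"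
proof (cases "W z = 0")
  case True
  then show ?thesis using m by (simp add: power_0_left)
next
  case False
  define c where "c = W z"
  have c: "norm c > 0" using False by (simp add: c_def)
  define F where "F w = ((\<Sum>j\<in>UNIV. cnj (c $ j) * W w $ j) / of_real (norm c)) ^ m" for w
  have F: "line_holomorphic_on F (ball z \<rho>)"
    unfolding F_def[abs_def] using c
    by (intro line_holomorphic_on_power line_holomorphic_on_divide line_holomorphic_on_sum
        line_holomorphic_on_mult line_holomorphic_on_const W) simp
  have F_z: "norm (F z) = norm (W z) ^ m"
    using c by (simp add: F_def sum_cnj_mult_self norm_power norm_divide flip: c_def)
       (simp add: power2_eq_square norm_mult)
  have F_le: "norm (F w) \<le> norm (W w) ^ m" for w
    unfolding F_def norm_power using c norm_sum_cnj_mult_le[of c "W w"]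
    by (intro power_mono) (simp_all add: norm_divide field_simps)
  have "ennreal (norm (W z) ^ m) * emeasure lborel (ball z \<rho>) \<le> (\<integral>\<^sup>+w\<in>ball z \<rho>. ennreal (norm (F w)) \<partial>lborel)"
    unfolding F_z[symmetric] using F by (intro sub_mean_value_ball) (auto simp: line_holomorphic_on_def)
  also have "\<dots> \<le> (\<integral>\<^sup>+w\<in>ball z \<rho>. ennreal (norm (W w) ^ m) \<partial>lborel)"
    by (intro nn_integral_mono mult_right_mono ennreal_leI F_le) auto
  finally show ?thesis .
qed

section \<open>Operator norm and dilatation\<close>

lemma norm_mult_le_op_norm: "norm (A *v v) \<le> op_norm A * norm v"
  unfolding op_norm_def by (rule onorm) simp

lemma op_norm_le: "(\<And>v. norm (A *v v) \<le> b * norm v) \<Longrightarrow> op_norm A \<le> b"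
  unfolding op_norm_def by (rule onorm_le)

lemma op_norm_nonneg: "op_norm A \<ge> 0"
  unfolding op_norm_def by (rule onorm_pos_le) simp

lemma component_le_norm: "norm (v $ j) \<le> norm v" for v :: "complex^'n"
  unfolding norm_vec_def by (rule member_le_L2_set) simp_all

lemma op_norm_le_sum: "op_norm A \<le> (\<Sum>i\<in>UNIV. \<Sum>j\<in>UNIV. norm (A $ i $ j))"
proof (rule op_norm_le)
  fix v :: "complex^'a"
  have "norm (A *v v) \<le> (\<Sum>i\<in>UNIV. norm ((A *v v) $ i))"
    unfolding norm_vec_def by (rule L2_set_le_sum) simp
  also have "\<dots> \<le> (\<Sum>i\<in>UNIV. \<Sum>j\<in>UNIV. norm (A $ i $ j) * norm v)"
    unfolding matrix_vector_mult_def vec_lambda_beta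
    by (intro sum_mono sum_norm_le) (simp add: norm_mult mult_left_mono component_le_norm)
  finally show "norm (A *v v) \<le> (\<Sum>i\<in>UNIV. \<Sum>j\<in>UNIV. norm (A $ i $ j)) * norm v"
    by (simp add: sum_distrib_right)
qed

lemma op_norm_diff_le: "\<bar>op_norm A - op_norm B\<bar> \<le> op_norm (A - B)"
proof -
  have tri: "op_norm A \<le> op_norm (A - B) + op_norm B" for A B :: "complex^'a^'a"
  proof (rule op_norm_le)
    fix v :: "complex^'a"
    have "norm (A *v v) = norm ((A - B) *v v + B *v v)"
      by (simp add: matrix_vector_mult_diff_rdistrib)
    also have "\<dots> \<le> op_norm (A - B) * norm v + op_norm B * norm v"
      by (intro norm_triangle_le add_mono norm_mult_le_op_norm)
    finally show "norm (A *v v) \<le> (op_norm (A - B) + op_norm B) * norm v"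
      by (simp add: algebra_simps)
  qed
  have "op_norm (B - A) = op_norm (A - B)"
    unfolding op_norm_def matrix_vector_mult_diff_rdistrib by (subst onorm_neg[symmetric]) simp
  then show ?thesis using tri[of A B] tri[of B A] by linarith
qed

lemma continuous_on_op_norm:
  fixes A :: "'b::topological_space \<Rightarrow> complex^'n^'n"
  assumes "\<And>i j. continuous_on S (\<lambda>z. A z $ i $ j)"
  shows "continuous_on S (\<lambda>z. op_norm (A z))"
  unfolding continuous_on_def
proof
  fix z assume z: "z \<in> S"
  have "((\<lambda>w. \<Sum>i\<in>UNIV. \<Sum>j\<in>UNIV. norm (A w $ i $ j - A z $ i $ j)) \<longlongrightarrow> (\<Sum>i\<in>(UNIV :: 'n set). \<Sum>j\<in>(UNIV :: 'n set). norm (A z $ i $ j - A z $ i $ j))) (at z within S)"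
    using assms z by (intro tendsto_sum tendsto_norm tendsto_diff tendsto_const) (auto simp: continuous_on_def)
  then have lim: "((\<lambda>w. \<Sum>i\<in>UNIV. \<Sum>j\<in>UNIV. norm (A w $ i $ j - A z $ i $ j)) \<longlongrightarrow> 0) (at z within S)"
    by simp
  have "\<bar>op_norm (A w) - op_norm (A z)\<bar> \<le> (\<Sum>i\<in>UNIV. \<Sum>j\<in>UNIV. norm (A w $ i $ j - A z $ i $ j))" for w
    using order_trans[OF op_norm_diff_le op_norm_le_sum, of "A w" "A z"] by simp
  then have "((\<lambda>w. op_norm (A w) - op_norm (A z)) \<longlongrightarrow> 0) (at z within S)"
    by (intro Lim_null_comparison[OF _ lim] always_eventually) simp
  then show "((\<lambda>w. op_norm (A w)) \<longlongrightarrow> op_norm (A z)) (at z within S)"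
    by (simp add: LIM_zero_iff)
qed

lemma matrix_inv:
  assumes "invertible A"
  shows "A ** matrix_inv A = mat 1" "matrix_inv A ** A = mat 1"
proof -
  have "A ** matrix_inv A = mat 1 \<and> matrix_inv A ** A = mat 1"
    using assms unfolding invertible_def matrix_inv_def by (rule someI_ex)
  then show "A ** matrix_inv A = mat 1" "matrix_inv A ** A = mat 1" by blast+
qed

text \<open>
  By Cramer's rule the inverse of the Jacobian matrix of \<open>h\<close> acts on \<open>u\<close> by quotients of determinants,
  which are polynomials in holomorphic entries.
\<close>

lemma line_holomorphic_on_dilatation_vector:
  fixes h g :: "complex^'n \<Rightarrow> complex^'n"
  assumes h: "holomorphic_map_on h S" and g: "holomorphic_map_on g S"
    and inv: "\<And>z. z \<in> S \<Longrightarrow> invertible (complex_jacobian h z)"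
  shows "line_holomorphic_on (\<lambda>z. ((complex_jacobian g z ** matrix_inv (complex_jacobian h z)) *v u) $ j) S"
proof -
  define X where "X z k = det (\<chi> i j. if j = k then u $ i else complex_jacobian h z $ i $ j) / det (complex_jacobian h z)" for z k
  have det: "det (complex_jacobian h z) \<noteq> 0" if "z \<in> S" for z
    using inv[OF that] by (simp add: invertible_det_nz)
  have X: "line_holomorphic_on (\<lambda>z. X z k) S" for k
    unfolding X_def
  proof (intro line_holomorphic_on_divide line_holomorphic_on_det det)
    show "line_holomorphic_on (\<lambda>z. (\<chi> i j. if j = k then u $ i else complex_jacobian h z $ i $ j) $ i $ j) S" for i j
      by (cases "j = k") (simp_all add: line_holomorphic_on_complex_jacobian[OF h])
  qed (rule line_holomorphic_on_complex_jacobian[OF h])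
  have "((complex_jacobian g z ** matrix_inv (complex_jacobian h z)) *v u) $ j = (\<Sum>k\<in>UNIV. complex_jacobian g z $ j $ k * X z k)"
    if z: "z \<in> S" for z
  proof -
    have "complex_jacobian h z *v (matrix_inv (complex_jacobian h z) *v u) = u"
      by (simp add: matrix_vector_mul_assoc matrix_inv(1)[OF inv[OF z]])
    then have "matrix_inv (complex_jacobian h z) *v u = (\<chi> k. X z k)"
      unfolding cramer[OF det[OF z]] X_def .
    then show ?thesis
      unfolding matrix_vector_mul_assoc[symmetric] by (simp only: matrix_vector_mult_def vec_lambda_beta)
  qed
  moreover have "line_holomorphic_on (\<lambda>z. \<Sum>k\<in>UNIV. complex_jacobian g z $ j $ k * X z k) S"
    by (intro line_holomorphic_on_sum line_holomorphic_on_mult X line_holomorphic_on_complex_jacobian[OF g])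
  ultimately show ?thesis
    by (subst line_holomorphic_on_cong)
qed

section \<open>The real Jacobian determinant\<close>

lemma of_real_vec_to_real_vec: "of_real_vec (to_real_vec z) = z"
  by (simp add: of_real_vec_def to_real_vec_def vec_eq_iff)

lemma norm_to_real_vec: "norm (to_real_vec z) = norm z"
proof -
  have "(\<Sum>i\<in>UNIV. (norm (to_real_vec z $ i))\<^sup>2) = (\<Sum>i\<in>UNIV <+> UNIV. (norm (to_real_vec z $ i))\<^sup>2)"
    by simp
  also have "\<dots> = (\<Sum>j\<in>UNIV. (Re (z $ j))\<^sup>2) + (\<Sum>j\<in>UNIV. (Im (z $ j))\<^sup>2)"
    by (subst sum.Plus) (simp_all add: to_real_vec_def)
  also have "\<dots> = (\<Sum>j\<in>UNIV. (norm (z $ j))\<^sup>2)"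
    by (simp add: cmod_power2 sum.distrib)
  finally show ?thesis by (simp add: norm_vec_def L2_set_def)
qed

lemma to_real_vec_of_real_vec: "to_real_vec (of_real_vec x) = x"
  by (simp add: of_real_vec_def to_real_vec_def vec_eq_iff split: sum.split)

lemma norm_of_real_vec: "norm (of_real_vec x) = norm x"
  using norm_to_real_vec[of "of_real_vec x"] by (simp add: to_real_vec_of_real_vec)

lemma bounded_linear_to_real_vec: "bounded_linear to_real_vec"
  unfolding linear_conv_bounded_linear[symmetric]
  by (rule linearI) (simp_all add: to_real_vec_def vec_eq_iff split: sum.split)

lemma bounded_linear_of_real_vec: "bounded_linear of_real_vec"
  unfolding linear_conv_bounded_linear[symmetric]
  by (rule linearI) (simp_all add: of_real_vec_def vec_eq_iff complex_eq_iff)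

lemma real_jacobian_mult:
  assumes f: "(f has_derivative (\<lambda>v. A *v v)) (at z)"
  shows "real_jacobian f z *v x = to_real_vec (A *v of_real_vec x)"
proof -
  have "(of_real_vec has_derivative of_real_vec) (at (to_real_vec z))"
    by (rule bounded_linear_imp_has_derivative[OF bounded_linear_of_real_vec])
  moreover have "(f has_derivative (\<lambda>v. A *v v)) (at (of_real_vec (to_real_vec z)))"
    using f by (simp add: of_real_vec_to_real_vec)
  ultimately have "((\<lambda>x. f (of_real_vec x)) has_derivative (\<lambda>x. A *v of_real_vec x)) (at (to_real_vec z))"
    by (rule has_derivative_compose)
  then have der: "((to_real_vec \<circ> f \<circ> of_real_vec) has_derivative (\<lambda>x. to_real_vec (A *v of_real_vec x))) (at (to_real_vec z))"
    unfolding o_def by (rule bounded_linear.has_derivative[OF bounded_linear_to_real_vec])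
  then have "((to_real_vec \<circ> f \<circ> of_real_vec) has_derivative (\<lambda>x. real_jacobian f z *v x)) (at (to_real_vec z))"
    unfolding real_jacobian_def by (subst jacobian_works[symmetric]) (rule differentiableI)
  with der show ?thesis
    by (blast dest: has_derivative_unique fun_cong)
qed

text \<open>
  The identification of \<open>\<complex>\<^sup>n\<close> with \<open>\<real>\<^sup>2\<^sup>n\<close> is isometric, so that the estimate for real matrices applies
  in dimension \<open>2n\<close>; the complex determinant is not involved.
\<close>

lemma abs_det_real_jacobian_mult_norm_le:
  fixes f :: "complex^'n \<Rightarrow> complex^'n"
  assumes f: "(f has_derivative (\<lambda>v. A *v v)) (at z)"
    and K: "K > 0" and A: "\<And>v. norm (A *v v) \<le> K * norm v"
  shows "\<bar>det (real_jacobian f z)\<bar> * norm v \<le> K ^ (2 * CARD('n) - 1) * norm (A *v v)"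
proof -
  have "\<bar>det (real_jacobian f z)\<bar> * norm (to_real_vec v)
      \<le> K ^ (card (UNIV :: ('n + 'n) set) - 1) * norm (real_jacobian f z *v to_real_vec v)"
    using K
  proof (rule abs_det_mult_norm_le)
    show "norm (real_jacobian f z *v x) \<le> K * norm x" for x
      using A[of "of_real_vec x"] by (simp add: real_jacobian_mult[OF f] norm_to_real_vec norm_of_real_vec)
  qed
  then show ?thesis
    by (simp add: real_jacobian_mult[OF f] norm_to_real_vec of_real_vec_to_real_vec mult_2)
qed

section \<open>A quantitative inverse function theorem\<close>

text \<open>
  On the closed ball of radius \<open>s < \<mu> / C\<close> the difference \<open>E = f - L\<close> has Lipschitz constant \<open>C s\<close>,
  which is less than \<open>\<mu>\<close>, whereas \<open>L\<close> expands distances by at least \<open>\<mu>\<close>: hence \<open>f\<close> is injective. To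
  solve \<open>f x = w\<close>, iterate the contraction \<open>x \<mapsto> L\<^sup>-\<^sup>1 (w - E x)\<close>. Integration along rays gives the
  better bound \<open>\<bar>E x\<bar> \<le> C \<bar>x\<bar>\<^sup>2 / 2\<close>, and the contraction preserves the ball of radius \<open>s\<close> as soon as
  \<open>\<bar>w\<bar> + C s\<^sup>2 / 2 \<le> \<mu> s\<close>.
\<close>

lemma inj_on_and_ball_covering:
  fixes f :: "'a::euclidean_space \<Rightarrow> 'a"
  assumes L: "linear L" and \<mu>: "\<mu> > 0" and lower: "\<And>v. \<mu> * norm v \<le> norm (L v)"
    and C: "C > 0" and der: "\<And>z. norm z < r \<Longrightarrow> (f has_derivative f' z) (at z)"
    and close: "\<And>z v. norm z < r \<Longrightarrow> norm (f' z v - L v) \<le> C * norm z * norm v"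
    and f0: "f 0 = 0" and r: "\<mu> / C \<le> r"
  shows "inj_on f (ball 0 (\<mu> / C))" and "ball 0 (\<mu>\<^sup>2 / (2 * C)) \<subseteq> f ` ball 0 (\<mu> / C)"
proof -
  have bl: "bounded_linear L" using L by (simp add: linear_conv_bounded_linear)
  define E where "E z = f z - L z" for z
  have derE: "(E has_derivative (\<lambda>v. f' z v - L v)) (at z)" if "norm z < r" for z
    unfolding E_def by (intro has_derivative_diff der that bounded_linear_imp_has_derivative bl)
  have lip: "norm (E x - E y) \<le> C * s * norm (x - y)" if s: "s < r" and x: "norm x \<le> s" and y: "norm y \<le> s" for x y s
  proof (rule differentiable_bound[of "cball 0 s" E "\<lambda>z v. f' z v - L v"])
    fix z assume "z \<in> cball (0 :: 'a) s"
    then have z: "norm z \<le> s" "norm z < r" using s by auto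
    show "(E has_derivative (\<lambda>v. f' z v - L v)) (at z within cball 0 s)"
      by (rule has_derivative_at_withinI[OF derE[OF z(2)]])
    show "onorm (\<lambda>v. f' z v - L v) \<le> C * s"
    proof (rule onorm_le)
      fix v :: 'a
      have "C * norm z * norm v \<le> C * s * norm v"
        using C z by (intro mult_right_mono mult_left_mono) auto
      then show "norm (f' z v - L v) \<le> C * s * norm v"
        using close[OF z(2), of v] by linarith
    qed
  qed (use x y in auto)
  show "inj_on f (ball 0 (\<mu> / C))"
  proof (rule inj_onI)
    fix x y assume x: "x \<in> ball 0 (\<mu> / C)" and y: "y \<in> ball 0 (\<mu> / C)" and eq: "f x = f y"
    define s where "s = max (norm x) (norm y)"
    have s: "s < \<mu> / C" "norm x \<le> s" "norm y \<le> s" using x y by (auto simp: s_def)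
    then have "C * s < \<mu>" using C by (simp add: field_simps)
    have "L (x - y) = - (E x - E y)"
      using eq by (simp add: E_def linear_diff[OF L])
    then have "\<mu> * norm (x - y) \<le> norm (E x - E y)"
      using lower[of "x - y"] by (simp only: norm_minus_cancel)
    also have "\<dots> \<le> C * s * norm (x - y)"
      using s r by (intro lip) auto
    finally have "(\<mu> - C * s) * norm (x - y) \<le> 0"
      by (simp add: algebra_simps)
    then show "x = y"
      using \<open>C * s < \<mu>\<close> by (simp add: mult_le_0_iff)
  qed
  have E_bound: "norm (E x) \<le> C / 2 * (norm x)\<^sup>2" if x: "norm x < r" for x
  proof -
    have "norm (E (1 *\<^sub>R x) - E (0 *\<^sub>R x)) \<le> C / 2 * (norm x)\<^sup>2 * 1\<^sup>2 - C / 2 * (norm x)\<^sup>2 * 0\<^sup>2"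
    proof (rule differentiable_bound_general[of 0 1 "\<lambda>t. E (t *\<^sub>R x)" "\<lambda>t. C / 2 * (norm x)\<^sup>2 * t\<^sup>2"
          "\<lambda>t. f' (t *\<^sub>R x) x - L x" "\<lambda>t. C * (norm x)\<^sup>2 * t"])
      have small: "norm (t *\<^sub>R x) < r" if "0 \<le> t" "t \<le> 1" for t
        using that x mult_left_le_one_le[of "norm x" t] by simp
      have vec: "((\<lambda>t. E (t *\<^sub>R x)) has_vector_derivative (f' (t *\<^sub>R x) x - L x)) (at t)" if "0 \<le> t" "t \<le> 1" for t
      proof -
        have "((\<lambda>t. t *\<^sub>R x) has_derivative (\<lambda>d. d *\<^sub>R x)) (at t)"
          by (auto intro!: derivative_eq_intros)
        from has_derivative_compose[OF this derE[OF small[OF that]]]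
        have "((\<lambda>t. E (t *\<^sub>R x)) has_derivative (\<lambda>d. f' (t *\<^sub>R x) (d *\<^sub>R x) - L (d *\<^sub>R x))) (at t)" .
        moreover have "linear (f' (t *\<^sub>R x))"
          using der[OF small[OF that]] by (rule has_derivative_linear)
        ultimately show ?thesis
          unfolding has_vector_derivative_def by (simp add: linear_cmul L scaleR_diff_right)
      qed
      show "continuous_on {0..1} (\<lambda>t. E (t *\<^sub>R x))"
        by (intro continuous_at_imp_continuous_on ballI has_vector_derivative_continuous[OF vec]) auto
      show "((\<lambda>t. E (t *\<^sub>R x)) has_vector_derivative (f' (t *\<^sub>R x) x - L x)) (at t)" if "0 < t" "t < 1" for t
        using that by (intro vec) auto
      show "((\<lambda>t. C / 2 * (norm x)\<^sup>2 * t\<^sup>2) has_vector_derivative C * (norm x)\<^sup>2 * t) (at t)" for t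
        by (auto intro!: derivative_eq_intros simp flip: has_real_derivative_iff_has_vector_derivative)
      show "norm (f' (t *\<^sub>R x) x - L x) \<le> C * (norm x)\<^sup>2 * t" if "0 < t" "t < 1" for t
        using close[OF small, of t x] that by (simp add: power2_eq_square mult_ac)
    qed (auto intro!: continuous_intros)
    then show ?thesis
      by (simp add: E_def f0 linear_0[OF L])
  qed
  have "inj L"
  proof (rule linear_injective_0[OF L, THEN iffD2], intro allI impI)
    fix v assume "L v = 0"
    then show "v = 0" using lower[of v] \<mu> by (simp add: mult_le_0_iff)
  qed
  then obtain G where G: "linear G" "\<And>v. G (L v) = v" "\<And>w. L (G w) = w"
    using linear_injective_isomorphism[OF L] by blast
  have G_le: "norm (G w) \<le> norm w / \<mu>" for w
    using lower[of "G w"] G \<mu> by (simp add: field_simps)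
  show "ball 0 (\<mu>\<^sup>2 / (2 * C)) \<subseteq> f ` ball 0 (\<mu> / C)"
  proof
    fix w assume "w \<in> ball (0 :: 'a) (\<mu>\<^sup>2 / (2 * C))"
    then have w: "norm w < \<mu>\<^sup>2 / (2 * C)" by simp
    \<comment> \<open>The smaller root of \<open>C s\<^sup>2 / 2 - \<mu> s + \<bar>w\<bar> = 0\<close>, which is less than \<open>\<mu> / C\<close>.\<close>
    define s where "s = (\<mu> - sqrt (\<mu>\<^sup>2 - 2 * C * norm w)) / C"
    have disc: "\<mu>\<^sup>2 - 2 * C * norm w > 0" using w C by (simp add: field_simps)
    have s_lt: "s < \<mu> / C" using disc C by (simp add: s_def divide_strict_right_mono)
    have "sqrt (\<mu>\<^sup>2 - 2 * C * norm w) \<le> sqrt (\<mu>\<^sup>2)"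
      using C by (intro real_sqrt_le_mono) simp
    then have s_nonneg: "s \<ge> 0" using C \<mu> by (simp add: s_def)
    have "(\<mu> - C * s)\<^sup>2 = \<mu>\<^sup>2 - 2 * C * norm w"
      using disc C by (simp add: s_def)
    then have "C * (norm w + C / 2 * s\<^sup>2) = C * (\<mu> * s)"
      by (simp add: power2_eq_square algebra_simps)
    then have s_eq: "norm w + C / 2 * s\<^sup>2 = \<mu> * s" using C by simp
    have s_r: "s < r" using s_lt r by simp
    have "\<exists>!x\<in>cball 0 s. G (w - E x) = x"
    proof (rule Banach_fix[where c = "C * s / \<mu>"])
      show "complete (cball (0 :: 'a) s)" by (simp add: complete_eq_closed)
      show "cball (0 :: 'a) s \<noteq> {}" using s_nonneg by simp
      show "0 \<le> C * s / \<mu>" "C * s / \<mu> < 1" using C \<mu> s_nonneg s_lt by (simp_all add: field_simps)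
      show "(\<lambda>x. G (w - E x)) ` cball 0 s \<subseteq> cball 0 s"
      proof safe
        fix x assume "x \<in> cball (0 :: 'a) s"
        then have x: "norm x \<le> s" by simp
        have "norm (w - E x) \<le> norm w + norm (E x)" by (rule norm_triangle_ineq4)
        also have "\<dots> \<le> norm w + C / 2 * (norm x)\<^sup>2"
          using E_bound[of x] x s_r by simp
        also have "\<dots> \<le> norm w + C / 2 * s\<^sup>2"
          using x C by (intro add_left_mono mult_left_mono power_mono) auto
        finally have "norm (w - E x) \<le> \<mu> * s" by (simp only: s_eq)
        then have "norm (G (w - E x)) \<le> \<mu> * s / \<mu>"
          using G_le[of "w - E x"] \<mu> by (meson order_trans divide_right_mono less_imp_le)
        then have "norm (G (w - E x)) \<le> s"
          using \<mu> by simp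
        then show "G (w - E x) \<in> cball 0 s" by simp
      qed
      show "dist (G (w - E x)) (G (w - E y)) \<le> C * s / \<mu> * dist x y" if "x \<in> cball 0 s" "y \<in> cball 0 s" for x y
      proof -
        have "dist (G (w - E x)) (G (w - E y)) = norm (G (E y - E x))"
          by (simp add: dist_norm linear_diff[OF G(1)])
        also have "\<dots> \<le> norm (E y - E x) / \<mu>" by (rule G_le)
        also have "\<dots> \<le> C * s * norm (y - x) / \<mu>"
          using that s_r \<mu> by (intro divide_right_mono lip) auto
        finally show ?thesis by (simp add: dist_norm norm_minus_commute)
      qed
    qed
    then obtain x where x: "norm x \<le> s" "G (w - E x) = x" by auto
    then have "L x = w - E x" using G(3)[of "w - E x"] by simp
    then have "f x = w" by (simp add: E_def)
    then show "w \<in> f ` ball 0 (\<mu> / C)" using x s_lt by force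
  qed
qed

section \<open>Distortion in the class \<open>\<P>\<H>(V)\<close>\<close>

text \<open>
  The Schwarz lemma, applied for each \<open>u\<close> to \<open>Dg(z) [Dh(z)]\<^sup>-\<^sup>1 u\<close>, which vanishes at the origin because
  \<open>Dg(0) = 0\<close>.
\<close>

lemma PHV_dilatation_le:
  assumes P: "PHV V f h g" and g0: "complex_jacobian g 0 = 0" and z: "norm z < 1"
  shows "dilatation h g z \<le> norm z"
  unfolding dilatation_def
proof (rule op_norm_le)
  fix u :: "complex^'a"
  have h: "holomorphic_map_on h (ball 0 1)" and g: "holomorphic_map_on g (ball 0 1)"
    and inv: "\<And>z. z \<in> ball 0 1 \<Longrightarrow> invertible (complex_jacobian h z)"
    and dil: "\<And>z. z \<in> ball 0 1 \<Longrightarrow> dilatation h g z < 1"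
    using P by (auto simp: PHV_def)
  have "norm ((complex_jacobian g z ** matrix_inv (complex_jacobian h z)) *v u) \<le> norm u * norm z / 1"
  proof (rule Schwarz_Lemma_vector[where W="\<lambda>z. (complex_jacobian g z ** matrix_inv (complex_jacobian h z)) *v u"])
    show "line_holomorphic_on (\<lambda>z. ((complex_jacobian g z ** matrix_inv (complex_jacobian h z)) *v u) $ j) (ball 0 1)" for j
      by (rule line_holomorphic_on_dilatation_vector[OF h g inv])
    show "norm ((complex_jacobian g z ** matrix_inv (complex_jacobian h z)) *v u) \<le> norm u" if "norm z < 1" for z
    proof -
      have "norm ((complex_jacobian g z ** matrix_inv (complex_jacobian h z)) *v u) \<le> dilatation h g z * norm u"
        unfolding dilatation_def by (rule norm_mult_le_op_norm)
      also have "\<dots> \<le> 1 * norm u"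
        using dil[of z] that by (intro mult_right_mono) auto
      finally show ?thesis by simp
    qed
  qed (use z g0 in \<open>simp_all add: matrix_vector_mul_assoc[symmetric]\<close>)
  then show "norm ((complex_jacobian g z ** matrix_inv (complex_jacobian h z)) *v u) \<le> norm z * norm u"
    by (simp add: mult.commute)
qed

lemma PHV_norm_jacobian_g_le:
  assumes P: "PHV V f h g" and g0: "complex_jacobian g 0 = 0" and z: "norm z < 1"
  shows "norm (complex_jacobian g z *v u) \<le> norm z * norm (complex_jacobian h z *v u)"
proof -
  have inv: "invertible (complex_jacobian h z)" using P z by (auto simp: PHV_def)
  have "complex_jacobian g z *v u = (complex_jacobian g z ** matrix_inv (complex_jacobian h z)) *v (complex_jacobian h z *v u)"
    by (simp add: matrix_vector_mul_assoc matrix_mul_assoc[symmetric] matrix_inv(2)[OF inv])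
  also have "norm \<dots> \<le> dilatation h g z * norm (complex_jacobian h z *v u)"
    unfolding dilatation_def by (rule norm_mult_le_op_norm)
  also have "\<dots> \<le> norm z * norm (complex_jacobian h z *v u)"
    by (intro mult_right_mono PHV_dilatation_le[OF P g0 z]) simp
  finally show ?thesis .
qed

lemma line_holomorphic_on_jacobian_mult:
  assumes h: "holomorphic_map_on h S"
  shows "line_holomorphic_on (\<lambda>z. (complex_jacobian h z *v u) $ j) S"
  unfolding matrix_vector_mult_def vec_lambda_beta
  by (intro line_holomorphic_on_sum line_holomorphic_on_mult line_holomorphic_on_const
      line_holomorphic_on_complex_jacobian[OF h])

text \<open>
  Without integrability the integral in \<open>gen_volume\<close> would be \<open>0\<close> by convention and would bound nothing.
\<close>

lemma PHV_set_integrable: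
  fixes h g :: "complex^'n \<Rightarrow> complex^'n"
  assumes P: "PHV V f h g" and r: "r < 1"
  shows "set_integrable lborel (ball 0 r)
    (\<lambda>z. op_norm (complex_jacobian h z) ^ (2 * CARD('n)) * (1 - (dilatation h g z)\<^sup>2) ^ CARD('n))"
proof -
  have h: "holomorphic_map_on h (ball 0 1)" and g: "holomorphic_map_on g (ball 0 1)"
    and inv: "\<And>z. z \<in> ball 0 1 \<Longrightarrow> invertible (complex_jacobian h z)"
    using P by (auto simp: PHV_def)
  have "continuous_on (ball 0 1) (\<lambda>z. op_norm (complex_jacobian h z))"
    using line_holomorphic_on_complex_jacobian[OF h]
    by (intro continuous_on_op_norm) (simp add: line_holomorphic_on_def)
  moreover have "continuous_on (ball 0 1) (dilatation h g)"
    unfolding dilatation_def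
  proof (rule continuous_on_op_norm)
    show "continuous_on (ball 0 1) (\<lambda>z. (complex_jacobian g z ** matrix_inv (complex_jacobian h z)) $ i $ j)" for i j
      using line_holomorphic_on_dilatation_vector[OF h g inv, of "axis j 1" i]
      by (simp add: line_holomorphic_on_def matrix_vector_mult_axis)
  qed
  ultimately have "continuous_on (ball 0 1)
      (\<lambda>z. op_norm (complex_jacobian h z) ^ (2 * CARD('n)) * (1 - (dilatation h g z)\<^sup>2) ^ CARD('n))"
    by (intro continuous_on_mult continuous_on_power continuous_on_diff continuous_on_const)
  then have "continuous_on (cball 0 r)
      (\<lambda>z. op_norm (complex_jacobian h z) ^ (2 * CARD('n)) * (1 - (dilatation h g z)\<^sup>2) ^ CARD('n))"
    by (rule continuous_on_subset) (use r in auto)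
  then have "set_integrable lborel (cball 0 r)
      (\<lambda>z. op_norm (complex_jacobian h z) ^ (2 * CARD('n)) * (1 - (dilatation h g z)\<^sup>2) ^ CARD('n))"
    unfolding set_integrable_def by (intro borel_integrable_compact) auto
  then show ?thesis
    by (rule set_integrable_subset) (auto simp: ball_subset_cball)
qed

text \<open>
  On the ball of radius \<open>R\<close> the dilatation is at most \<open>R\<close>, so that the volume integrand is at least
  \<open>(1 - R\<^sup>2) ^ n\<close> times \<open>\<parallel>Dh\<parallel> ^ (2n)\<close>. The sub-mean value inequality on the ball of radius \<open>\<rho>\<close> about \<open>z\<close>,
  whose normalized volume is \<open>\<rho> ^ (2n)\<close>, turns the bound \<open>V\<close> for the integral into a pointwise bound.
\<close>

lemma PHV_distortion:
  fixes h g :: "complex^'n \<Rightarrow> complex^'n"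
  assumes V: "V \<ge> 0" and P: "PHV V f h g" and g0: "complex_jacobian g 0 = 0"
    and \<rho>: "\<rho> > 0" "norm z + \<rho> \<le> R" "R < 1"
  shows "norm (complex_jacobian h z *v u) ^ (2 * CARD('n)) * (\<rho>\<^sup>2 * (1 - R\<^sup>2)) ^ CARD('n)
    \<le> V * norm u ^ (2 * CARD('n))"
proof -
  define n where "n = CARD('n)"
  have n: "n > 0" by (simp add: n_def)
  have R: "R > 0" using \<rho> norm_ge_zero[of z] by linarith
  define \<Phi> where "\<Phi> w = op_norm (complex_jacobian h w) ^ (2 * n) * (1 - (dilatation h g w)\<^sup>2) ^ n" for w
  define q where "q = (1 - R\<^sup>2) ^ n"
  define \<omega> where "\<omega> = measure lborel (ball (0 :: complex^'n) 1)"
  define b where "b = norm u ^ (2 * n)"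
  have h: "holomorphic_map_on h (ball 0 1)" using P by (simp add: PHV_def)
  have R2: "1 - R\<^sup>2 > 0" using R \<rho>(3) by (simp add: power_less_one_iff)
  then have q: "q > 0" by (simp add: q_def)
  have \<omega>: "\<omega> > 0" by (simp add: \<omega>_def)
  have sub: "ball z \<rho> \<subseteq> ball 0 R"
  proof
    fix w assume "w \<in> ball z \<rho>"
    then show "w \<in> ball 0 R"
      using \<rho>(2) norm_triangle_ineq4[of z "z - w"] by (simp add: dist_norm)
  qed
  have \<Phi>_lower: "norm (complex_jacobian h w *v u) ^ (2 * n) \<le> b / q * \<Phi> w" if w: "w \<in> ball 0 R" for w
  proof -
    have w1: "norm w < 1" and wR: "norm w \<le> R" using w \<rho>(3) by auto
    have "dilatation h g w \<le> R"
      using PHV_dilatation_le[OF P g0 w1] wR by linarith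
    moreover have "dilatation h g w \<ge> 0" unfolding dilatation_def by (rule op_norm_nonneg)
    ultimately have "q \<le> (1 - (dilatation h g w)\<^sup>2) ^ n"
      unfolding q_def using R2 by (intro power_mono diff_left_mono) auto
    moreover have "norm (complex_jacobian h w *v u) ^ (2 * n) \<le> (op_norm (complex_jacobian h w) * norm u) ^ (2 * n)"
      by (intro power_mono norm_mult_le_op_norm) simp
    ultimately have "q * norm (complex_jacobian h w *v u) ^ (2 * n)
        \<le> (1 - (dilatation h g w)\<^sup>2) ^ n * (op_norm (complex_jacobian h w) * norm u) ^ (2 * n)"
      using q by (intro mult_mono) auto
    then show ?thesis using q by (simp add: \<Phi>_def b_def power_mult_distrib field_simps)
  qed
  have \<Phi>_nonneg: "\<Phi> w \<ge> 0" if w: "w \<in> ball 0 R" for w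
  proof -
    have "0 \<le> dilatation h g w" "dilatation h g w < 1"
      using P w \<rho>(3) unfolding PHV_def by (auto simp: dilatation_def op_norm_nonneg)
    then have "(dilatation h g w)\<^sup>2 \<le> 1" by (simp add: power_le_one)
    then show ?thesis by (simp add: \<Phi>_def op_norm_nonneg)
  qed
  have int: "set_integrable lborel (ball 0 R) \<Phi>"
    unfolding \<Phi>_def n_def by (rule PHV_set_integrable[OF P \<rho>(3)])
  have "gen_volume h g R \<le> V"
    using P R \<rho>(3) unfolding PHV_def by (metis cSUP_upper greaterThanLessThan_iff)
  then have vol: "(LINT w:ball 0 R|lborel. \<Phi> w) \<le> V * \<omega>"
    using \<omega> by (simp add: gen_volume_def \<Phi>_def n_def \<omega>_def divide_le_eq)
  have emeasure: "emeasure lborel (ball z \<rho>) = ennreal (\<rho> ^ (2 * n) * \<omega>)"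
  proof -
    have "measure lborel (ball z \<rho>) = \<rho> ^ (2 * n) * \<omega>"
      using content_ball[of \<rho> z] content_ball[of 1 "0 :: complex^'n"] \<rho>(1)
      by (simp add: \<omega>_def n_def mult.commute)
    then show ?thesis
      using emeasure_lborel_ball_finite[of z \<rho>] by (simp add: emeasure_eq_ennreal_measure less_top)
  qed
  have "ennreal (norm (complex_jacobian h z *v u) ^ (2 * n) * (\<rho> ^ (2 * n) * \<omega>))
      = ennreal (norm (complex_jacobian h z *v u) ^ (2 * n)) * emeasure lborel (ball z \<rho>)"
    unfolding emeasure using \<omega> \<rho>(1) by (simp add: ennreal_mult)
  also have "\<dots> \<le> (\<integral>\<^sup>+w\<in>ball z \<rho>. ennreal (norm (complex_jacobian h w *v u) ^ (2 * n)) \<partial>lborel)"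
  proof (rule sub_mean_value_norm_power)
    have "ball z \<rho> \<subseteq> ball 0 1" using sub \<rho>(3) by auto
    then show "line_holomorphic_on (\<lambda>w. (complex_jacobian h w *v u) $ j) (ball z \<rho>)" for j
      by (rule line_holomorphic_on_subset[OF line_holomorphic_on_jacobian_mult[OF h]])
  qed (use n in simp)
  also have "\<dots> \<le> (\<integral>\<^sup>+w. ennreal (b / q * (indicator (ball 0 R) w *\<^sub>R \<Phi> w)) \<partial>lborel)"
  proof (rule nn_integral_mono)
    fix w
    show "ennreal (norm (complex_jacobian h w *v u) ^ (2 * n)) * indicator (ball z \<rho>) w
        \<le> ennreal (b / q * (indicator (ball 0 R) w *\<^sub>R \<Phi> w))"
      using sub \<Phi>_lower[of w] by (auto simp: indicator_def intro!: ennreal_leI)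
  qed
  also have "\<dots> = ennreal (LINT w|lborel. b / q * (indicator (ball 0 R) w *\<^sub>R \<Phi> w))"
  proof (rule nn_integral_eq_integral)
    show "integrable lborel (\<lambda>w. b / q * (indicator (ball 0 R) w *\<^sub>R \<Phi> w))"
      using int unfolding set_integrable_def by (rule integrable_mult_right)
    show "AE w in lborel. 0 \<le> b / q * (indicator (ball 0 R) w *\<^sub>R \<Phi> w)"
      using \<Phi>_nonneg q by (intro always_eventually) (auto simp: indicator_def b_def)
  qed
  also have "(LINT w|lborel. b / q * (indicator (ball 0 R) w *\<^sub>R \<Phi> w)) = b / q * (LINT w:ball 0 R|lborel. \<Phi> w)"
    by (simp add: set_lebesgue_integral_def)
  also have "ennreal \<dots> \<le> ennreal (b / q * (V * \<omega>))"
    using q by (intro ennreal_leI mult_left_mono vol) (simp add: b_def)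
  finally have "norm (complex_jacobian h z *v u) ^ (2 * n) * (\<rho> ^ (2 * n) * \<omega>) \<le> b / q * (V * \<omega>)"
    using q V \<omega> by (subst (asm) ennreal_le_iff) (simp_all add: b_def)
  then have "\<omega> * (norm (complex_jacobian h z *v u) ^ (2 * n) * (\<rho> ^ (2 * n) * q)) \<le> \<omega> * (V * b)"
    using q by (simp add: field_simps)
  then have "norm (complex_jacobian h z *v u) ^ (2 * n) * (\<rho> ^ (2 * n) * q) \<le> V * b"
    using \<omega> by simp
  then show ?thesis
    by (simp add: q_def b_def n_def power_mult_distrib flip: power_mult)
qed

text \<open>
  The \<open>2n\<close>-th root of \<open>V \<psi>\<^sub>0 ^ n\<close>, a bound for \<open>\<parallel>Dh(z)\<parallel>\<close> on the ball of radius \<open>1/4\<close>.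
\<close>

definition growth_const :: "real \<Rightarrow> nat \<Rightarrow> real"
  where "growth_const V n = V powr (1 / (2 * real n)) * \<psi>\<^sub>0 powr (1 / 2)"

lemma \<psi>\<^sub>0_ge: "64 / 7 \<le> \<psi>\<^sub>0"
proof -
  have "2 \<le> sqrt 5" by (rule real_le_rsqrt) simp
  then show ?thesis by (simp add: \<psi>\<^sub>0_def)
qed

lemma landau_constant_le: "pi * (sqrt 5 - 1) * (3 - 2 * sqrt 2) / 8 \<le> 1 / 9"
proof -
  have s5: "sqrt 5 \<le> 9 / 4" by (rule real_le_lsqrt) (simp_all add: power2_eq_square)
  have s2: "353 / 250 \<le> sqrt 2" by (rule real_le_rsqrt) (simp add: power2_eq_square)
  have s2': "sqrt 2 \<le> 3 / 2" by (rule real_le_lsqrt) (simp_all add: power2_eq_square)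
  have "pi * (sqrt 5 - 1) * (3 - 2 * sqrt 2) \<le> 4 * (9 / 4 - 1) * (3 - 2 * (353 / 250))"
    using s5 s2 s2' pi_less_4 by (intro mult_mono) auto
  then show ?thesis by simp
qed

lemma growth_const_power:
  assumes V: "V > 0" and n: "n > 0"
  shows "growth_const V n > 0" and "growth_const V n ^ (2 * n) = V * \<psi>\<^sub>0 ^ n"
    and "growth_const V n ^ (4 * n - 1) = V powr ((4 * real n - 1) / (2 * real n)) * \<psi>\<^sub>0 powr ((4 * real n - 1) / 2)"
proof -
  have \<psi>: "\<psi>\<^sub>0 > 0" using \<psi>\<^sub>0_ge by linarith
  have pow: "growth_const V n ^ k = V powr (real k / (2 * real n)) * \<psi>\<^sub>0 powr (real k / 2)" for k
    unfolding growth_const_def using V \<psi>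
    by (simp add: power_mult_distrib powr_power)
  show "growth_const V n > 0" using V \<psi> by (simp add: growth_const_def)
  show "growth_const V n ^ (2 * n) = V * \<psi>\<^sub>0 ^ n"
    unfolding pow using V \<psi> n by (simp add: powr_realpow)
  have "real (4 * n - 1) = 4 * real n - 1" using n by simp
  then show "growth_const V n ^ (4 * n - 1) = V powr ((4 * real n - 1) / (2 * real n)) * \<psi>\<^sub>0 powr ((4 * real n - 1) / 2)"
    unfolding pow by simp
qed

text \<open>
  The radii \<open>\<rho> = 1/2\<close> and \<open>R = 3/4\<close> give \<open>\<rho>\<^sup>2 (1 - R\<^sup>2) = 7/64\<close>, and \<open>64/7\<close> is less than \<open>\<psi>\<^sub>0\<close>.
\<close>

lemma PHV_jacobian_le:
  fixes h g :: "complex^'n \<Rightarrow> complex^'n"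
  assumes V: "V > 0" and P: "PHV V f h g" and g0: "complex_jacobian g 0 = 0" and z: "norm z < 1 / 4"
  shows "norm (complex_jacobian h z *v u) \<le> growth_const V CARD('n) * norm u"
proof -
  let ?n = "CARD('n)" and ?x = "norm (complex_jacobian h z *v u)"
  have n: "?n > 0" by simp
  have "?x ^ (2 * ?n) * ((1 / 2)\<^sup>2 * (1 - (3 / 4)\<^sup>2)) ^ ?n \<le> V * norm u ^ (2 * ?n)"
    using V z by (intro PHV_distortion[OF _ P g0]) auto
  then have "?x ^ (2 * ?n) * (7 / 64) ^ ?n \<le> V * norm u ^ (2 * ?n)"
    by (simp add: power2_eq_square)
  then have "?x ^ (2 * ?n) \<le> V * (64 / 7) ^ ?n * norm u ^ (2 * ?n)"
    by (simp add: power_divide field_simps)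
  also have "\<dots> \<le> V * \<psi>\<^sub>0 ^ ?n * norm u ^ (2 * ?n)"
    using V \<psi>\<^sub>0_ge by (intro mult_right_mono mult_left_mono power_mono) auto
  also have "\<dots> = (growth_const V ?n * norm u) ^ (2 * ?n)"
    using growth_const_power(2)[OF V n] by (simp add: power_mult_distrib)
  finally show ?thesis
    using growth_const_power(1)[OF V n] by (subst (asm) power_mono_iff) auto
qed

lemma bounded_linear_vec_cnj: "bounded_linear vec_cnj"
  unfolding linear_conv_bounded_linear[symmetric]
  by (rule linearI) (simp_all add: vec_cnj_def vec_eq_iff)

lemma norm_vec_cnj: "norm (vec_cnj z) = norm z"
  by (simp add: vec_cnj_def norm_vec_def)

lemma PHV_has_derivative:
  assumes P: "PHV V f h g" and z: "norm z < 1"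
  shows "(f has_derivative (\<lambda>v. complex_jacobian h z *v v + vec_cnj (complex_jacobian g z *v v))) (at z)"
proof (rule has_derivative_transform_within_open)
  have h: "holomorphic_map_on h (ball 0 1)" and g: "holomorphic_map_on g (ball 0 1)"
    using P by (auto simp: PHV_def)
  show "((\<lambda>z. h z + vec_cnj (g z)) has_derivative
      (\<lambda>v. complex_jacobian h z *v v + vec_cnj (complex_jacobian g z *v v))) (at z)"
    using z by (intro has_derivative_add bounded_linear.has_derivative[OF bounded_linear_vec_cnj]
        has_derivative_complex_jacobian(1)[OF h] has_derivative_complex_jacobian(1)[OF g]) simp_all
  show "h w + vec_cnj (g w) = f w" if "w \<in> ball 0 1" for w
    using P that by (simp add: PHV_def)
qed (use z in auto)

text \<open>
  On the ball of radius \<open>1/4\<close> the difference \<open>Dh(z) - Dh(0)\<close> has norm at most twice the growth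
  constant, so by the Schwarz lemma it contributes \<open>2 / (1/4) = 8\<close> to the factor \<open>9\<close>; the remaining \<open>1\<close>
  comes from \<open>\<parallel>Dg(z)\<parallel> \<le> \<parallel>z\<parallel> \<parallel>Dh(z)\<parallel>\<close>.
\<close>

lemma PHV_derivative_close:
  fixes h g :: "complex^'n \<Rightarrow> complex^'n"
  assumes V: "V > 0" and P: "PHV V f h g" and g0: "complex_jacobian g 0 = 0" and z: "norm z < 1 / 4"
  shows "norm ((complex_jacobian h z *v v + vec_cnj (complex_jacobian g z *v v)) - complex_jacobian h 0 *v v)
    \<le> 9 * growth_const V CARD('n) * norm z * norm v"
proof -
  define M where "M = growth_const V CARD('n)"
  have bound: "norm (complex_jacobian h z *v v) \<le> M * norm v" if "norm z < 1 / 4" for z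
    unfolding M_def by (rule PHV_jacobian_le[OF V P g0 that])
  have h: "holomorphic_map_on h (ball 0 1)" using P by (simp add: PHV_def)
  have "norm (complex_jacobian h z *v v - complex_jacobian h 0 *v v) \<le> (2 * M * norm v) * norm z / (1 / 4)"
  proof (rule Schwarz_Lemma_vector[where W="\<lambda>z. complex_jacobian h z *v v - complex_jacobian h 0 *v v"])
    have "line_holomorphic_on (\<lambda>z. (complex_jacobian h z *v v - complex_jacobian h 0 *v v) $ j) (ball 0 1)" for j
      unfolding diff_conv_add_uminus vector_add_component
      by (intro line_holomorphic_on_add line_holomorphic_on_jacobian_mult[OF h] line_holomorphic_on_const)
    then show "line_holomorphic_on (\<lambda>z. (complex_jacobian h z *v v - complex_jacobian h 0 *v v) $ j) (ball 0 (1 / 4))" for j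
      by (rule line_holomorphic_on_subset) auto
    show "norm (complex_jacobian h z *v v - complex_jacobian h 0 *v v) \<le> 2 * M * norm v" if "norm z < 1 / 4" for z
      using norm_triangle_ineq4[of "complex_jacobian h z *v v" "complex_jacobian h 0 *v v"] bound[OF that] bound[of 0]
      by simp
  qed (use z in simp_all)
  moreover have "norm (vec_cnj (complex_jacobian g z *v v)) \<le> norm z * (M * norm v)"
  proof -
    have "norm (complex_jacobian g z *v v) \<le> norm z * norm (complex_jacobian h z *v v)"
      using z by (intro PHV_norm_jacobian_g_le[OF P g0]) simp
    also have "\<dots> \<le> norm z * (M * norm v)"
      by (intro mult_left_mono bound z) simp
    finally show ?thesis by (simp add: norm_vec_cnj)
  qed
  moreover have "norm ((complex_jacobian h z *v v + vec_cnj (complex_jacobian g z *v v)) - complex_jacobian h 0 *v v)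
      \<le> norm (complex_jacobian h z *v v - complex_jacobian h 0 *v v) + norm (vec_cnj (complex_jacobian g z *v v))"
    using norm_triangle_ineq[of "complex_jacobian h z *v v - complex_jacobian h 0 *v v" "vec_cnj (complex_jacobian g z *v v)"]
    by (simp add: algebra_simps)
  ultimately show ?thesis
    by (simp add: M_def algebra_simps)
qed

section \<open>Univalence and covering\<close>

theorem theorem3:
  fixes f h g :: "complex^'n \<Rightarrow> complex^'n" and V \<alpha> :: real
  assumes "V > 0"
    and "PHV V f h g"
    and "f 0 = 0"
    and "complex_jacobian g 0 = 0"
    and "\<bar>det (real_jacobian f 0)\<bar> = \<alpha>"
    and "0 < \<alpha>"
    and "\<alpha> \<le> 8 * V * \<psi>\<^sub>0 ^ CARD('n) / pi"
  shows "\<exists>R\<^sub>u R\<^sub>c :: real.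
    ball (0 :: complex^'n) R\<^sub>u \<subseteq> ball 0 1 \<and>
    inj_on f (ball 0 R\<^sub>u) \<and>
    ball 0 R\<^sub>c \<subseteq> f ` ball 0 R\<^sub>u \<and>
    R\<^sub>u \<ge> \<alpha> * pi * (sqrt 5 - 1) * (3 - 2 * sqrt 2) / (8 * V * \<psi>\<^sub>0 ^ CARD('n)) \<and>
    R\<^sub>c \<ge> \<alpha>\<^sup>2 * pi * (sqrt 5 - 1) * (3 - 2 * sqrt 2)
      / (16 * V powr ((4 * real CARD('n) - 1) / (2 * real CARD('n)))
            * \<psi>\<^sub>0 powr ((4 * real CARD('n) - 1) / 2))"
proof -
  let ?n = "CARD('n)"
  define M where "M = growth_const V ?n"
  define A where "A = complex_jacobian h 0"
  define \<mu> where "\<mu> = \<alpha> / M ^ (2 * ?n - 1)"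
  define \<kappa> where "\<kappa> = pi * (sqrt 5 - 1) * (3 - 2 * sqrt 2) / 8"
  have n: "?n > 0" by simp
  note V = assms(1) and P = assms(2) and g0 = assms(4)
  have M: "M > 0" and M_2n: "M ^ (2 * ?n) = V * \<psi>\<^sub>0 ^ ?n"
    and M_4n: "M ^ (4 * ?n - 1) = V powr ((4 * real ?n - 1) / (2 * real ?n)) * \<psi>\<^sub>0 powr ((4 * real ?n - 1) / 2)"
    using growth_const_power[OF V n] by (simp_all add: M_def)
  have \<kappa>: "\<kappa> \<le> 1 / 9" unfolding \<kappa>_def by (rule landau_constant_le)
  have A_le: "norm (A *v v) \<le> M * norm v" for v
    unfolding A_def M_def by (rule PHV_jacobian_le[OF V P g0]) simp
  have der0: "(f has_derivative (\<lambda>v. A *v v)) (at 0)"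
    using PHV_has_derivative[OF P, of 0] g0 by (simp add: A_def vec_cnj_def zero_vec_def[symmetric])
  have det_le: "\<alpha> * norm v \<le> M ^ (2 * ?n - 1) * norm (A *v v)" for v
    using abs_det_real_jacobian_mult_norm_le[OF der0 M A_le] assms(5) by simp
  have lower: "\<mu> * norm v \<le> norm (A *v v)" for v
    using det_le[of v] M by (simp add: \<mu>_def field_simps)
  have \<mu>: "\<mu> > 0" using assms(6) M by (simp add: \<mu>_def)
  obtain e :: "complex^'n" where e: "norm e = 1" by (rule vector_choose_size[of 1]) simp
  \<comment> \<open>A lower bound of \<open>A\<close> cannot exceed an upper bound; this puts the radius \<open>\<mu> / (9 * M)\<close> inside the
    ball of radius \<open>1/4\<close> on which the estimates hold.\<close>
  have "\<mu> \<le> M" using order_trans[OF lower A_le, of e] e by simp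
  then have small: "\<mu> / (9 * M) \<le> 1 / 4" using M by (simp add: field_simps)
  have linA: "linear (\<lambda>v. A *v v)" by (simp add: linear_conv_bounded_linear)
  have close: "norm ((complex_jacobian h z *v v + vec_cnj (complex_jacobian g z *v v)) - A *v v) \<le> 9 * M * norm z * norm v"
    if "norm z < 1 / 4" for z v
    unfolding A_def M_def by (rule PHV_derivative_close[OF V P g0 that])
  have der: "(f has_derivative (\<lambda>v. complex_jacobian h z *v v + vec_cnj (complex_jacobian g z *v v))) (at z)"
    if "norm z < 1 / 4" for z
    using that by (intro PHV_has_derivative[OF P]) simp
  have M9: "9 * M > 0" using M by simp
  note covering = inj_on_and_ball_covering[OF linA \<mu> lower M9 der close assms(3) small]
  have R_u: "\<mu> / (9 * M) = \<alpha> / (9 * M ^ (2 * ?n))"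
    using power_Suc[of M "2 * ?n - 1"] n by (simp add: \<mu>_def)
  have R_c: "\<mu>\<^sup>2 / (2 * (9 * M)) = \<alpha>\<^sup>2 / (18 * M ^ (4 * ?n - 1))"
  proof -
    have "4 * ?n - 1 = (2 * ?n - 1) + (2 * ?n - 1) + 1" using n by arith
    then have "M ^ (4 * ?n - 1) = (M ^ (2 * ?n - 1))\<^sup>2 * M"
      by (simp only: power_add power2_eq_square power_one_right)
    then show ?thesis by (simp add: \<mu>_def power_divide)
  qed
  show ?thesis
  proof (intro exI conjI)
    show "ball (0 :: complex^'n) (\<mu> / (9 * M)) \<subseteq> ball 0 1"
      using small by (intro subset_ball) simp
    show "inj_on f (ball 0 (\<mu> / (9 * M)))" by (rule covering(1))
    show "ball 0 (\<mu>\<^sup>2 / (2 * (9 * M))) \<subseteq> f ` ball 0 (\<mu> / (9 * M))" by (rule covering(2))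
    have "\<alpha> * \<kappa> / M ^ (2 * ?n) \<le> \<alpha> * (1 / 9) / M ^ (2 * ?n)"
      using assms(6) M \<kappa> by (intro divide_right_mono mult_left_mono) auto
    then show "\<mu> / (9 * M) \<ge> \<alpha> * pi * (sqrt 5 - 1) * (3 - 2 * sqrt 2) / (8 * V * \<psi>\<^sub>0 ^ ?n)"
      unfolding R_u M_2n \<kappa>_def by (simp add: mult.assoc)
    have "\<alpha>\<^sup>2 * (\<kappa> / 2) / M ^ (4 * ?n - 1) \<le> \<alpha>\<^sup>2 * (1 / 18) / M ^ (4 * ?n - 1)"
      using M \<kappa> by (intro divide_right_mono mult_left_mono) auto
    then show "\<mu>\<^sup>2 / (2 * (9 * M)) \<ge> \<alpha>\<^sup>2 * pi * (sqrt 5 - 1) * (3 - 2 * sqrt 2)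
      / (16 * V powr ((4 * real ?n - 1) / (2 * real ?n)) * \<psi>\<^sub>0 powr ((4 * real ?n - 1) / 2))"
      unfolding R_c M_4n \<kappa>_def by (simp add: mult.assoc)
  qed
qed

end
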